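(* Let $M$ be a smooth manifold, $f\in C^\infty(M)$ and $\theta$ a closed $1$-form on $M$. Then the cohomology of the complex $(\Omega^\bullet_f(M),d_\theta)$ of singular forms is isomorphic to $H^\bullet_{f,\theta}(M)$.
   Context: $\Omega^r(M)$ is the space of smooth real $r$-forms on $M$. Let $S=f^{-1}(\{0\})$. A form $\varphi\in\Omega^r(M\setminus S)$ is called a singular $r$-form if $f^r\varphi$ can be extended to a smooth $r$-form on the whole of $M$; the space of singular $r$-forms is denoted $\Omega^r_f(M)$. The operator $d_\theta\varphi=d\varphi-\theta\wedge\varphi$ satisfies $d_\theta^2=0$ and maps singular $r$-forms to singular $(r+1)$-forms, so $(\Omega^\bullet_f(M),d_\theta)$ is a complex. For $\varphi\in\Omega^r(M)$ put $d_f\varphi=f\,d\varphi-r\,df\wedge\varphi$ and $d_{f,\theta}\varphi=d_f\varphi-f\theta\wedge\varphi$. Then $d_{f,\theta}^2=0$, and $H^\bullet_{f,\theta}(M)$ is the cohomology of $(\Omega^\bullet(M),d_{f,\theta})$.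
   Formalization: The formal statement adds the hypothesis that S = f^{-1}({0}) has empty interior; without it the claim fails, e.g. for f = 0 on M = R, where all singular forms vanish but H^0_{f,θ}(M) = C^∞(M) is nonzero. *)

theory Defs
  imports "HOL-Analysis.Analysis" "HOL-Library.Function_Algebras"
begin

section \<open>Pointwise vector space structure on functions\<close>

instantiation "fun" :: (type, real_vector) real_vector
begin

definition scaleR_fun :: "real \<Rightarrow> ('a \<Rightarrow> 'b) \<Rightarrow> 'a \<Rightarrow> 'b"
  where "scaleR_fun c g = (\<lambda>x. c *\<^sub>R g x)"

instance
  by standard (simp_all add: scaleR_fun_def plus_fun_def fun_eq_iff algebra_simps)

end

section \<open>Smooth manifolds\<close>

text \<open>On an open subset of a finite-dimensional space, the case \<open>Suc n\<close> says that all iterated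
  directional derivatives up to order \<open>Suc n\<close> exist and are continuous, i.e. \<open>g\<close> is of class
  \<open>C\<close> to the order \<open>Suc n\<close>.\<close>

fun cont_diff_on :: "nat \<Rightarrow> 'e::real_normed_vector set \<Rightarrow> ('e \<Rightarrow> 'b::real_normed_vector) \<Rightarrow> bool"
  where
    "cont_diff_on 0 S g \<longleftrightarrow> continuous_on S g"
  | "cont_diff_on (Suc n) S g \<longleftrightarrow>
       (\<forall>x\<in>S. g differentiable (at x)) \<and>
       (\<forall>v. cont_diff_on n S (\<lambda>x. frechet_derivative g (at x) v))"

definition smooth_on :: "'e::real_normed_vector set \<Rightarrow> ('e \<Rightarrow> 'b::real_normed_vector) \<Rightarrow> bool"
  where "smooth_on S g \<longleftrightarrow> (\<forall>n. cont_diff_on n S g)"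

text \<open>A chart is a pair of its domain and a map whose values matter only on that domain.\<close>

type_synonym ('a, 'e) chart = "'a set \<times> ('a \<Rightarrow> 'e)"

abbreviation chart_inv :: "('a, 'e) chart \<Rightarrow> 'e \<Rightarrow> 'a"
  where "chart_inv c \<equiv> inv_into (fst c) (snd c)"

text \<open>\<open>A\<close> is a smooth atlas, not necessarily maximal, on the space \<open>X\<close>. The model space is a
  finite-dimensional inner product space rather than a type of class \<open>euclidean_space\<close>, because
  the latter has positive dimension and would exclude manifolds of dimension 0.\<close>

locale smooth_manifold =
  fixes X :: "'a topology" and A :: "('a, 'e::real_inner) chart set"
  assumes finite_dim: "\<exists>B::'e set. finite B \<and> span B = UNIV"
    and hausdorff: "Hausdorff_space X"
    and second_countable: "second_countable X"
    and chart_domain: "c \<in> A \<Longrightarrow> openin X (fst c)"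
    and chart_image: "c \<in> A \<Longrightarrow> open (snd c ` fst c)"
    and chart_homeo:
      "c \<in> A \<Longrightarrow> homeomorphic_map (subtopology X (fst c)) (top_of_set (snd c ` fst c)) (snd c)"
    and charts_cover: "(\<Union>c\<in>A. fst c) = topspace X"
    and charts_compatible:
      "c \<in> A \<Longrightarrow> c' \<in> A \<Longrightarrow> smooth_on (snd c ` (fst c \<inter> fst c')) (snd c' \<circ> chart_inv c)"

definition smooth_fun :: "('a, 'e::real_inner) chart set \<Rightarrow> ('a \<Rightarrow> real) \<Rightarrow> bool"
  where "smooth_fun A f \<longleftrightarrow> (\<forall>c\<in>A. smooth_on (snd c ` fst c) (f \<circ> chart_inv c))"

section \<open>Tangent spaces\<close>

text \<open>A tangent vector at \<open>p\<close> is the family of its coordinate vectors, one for each chart around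
  \<open>p\<close>, which are related by the derivatives of the coordinate changes; the entries at all other
  arguments are \<open>0\<close>, so that equality of tangent vectors is equality of functions.\<close>

type_synonym ('a, 'e) tangent = "('a, 'e) chart \<Rightarrow> 'e"

definition charts_at :: "('a, 'e) chart set \<Rightarrow> 'a \<Rightarrow> ('a, 'e) chart set"
  where "charts_at A p = {c \<in> A. p \<in> fst c}"

definition coord_change :: "('a, 'e::real_inner) chart \<Rightarrow> ('a, 'e) chart \<Rightarrow> 'a \<Rightarrow> 'e \<Rightarrow> 'e"
  where "coord_change c c' p = frechet_derivative (snd c' \<circ> chart_inv c) (at (snd c p))"

definition tangent_space :: "('a, 'e::real_inner) chart set \<Rightarrow> 'a \<Rightarrow> ('a, 'e) tangent set"
  where "tangent_space A p =
    {v. (\<forall>c\<in>charts_at A p. \<forall>c'\<in>charts_at A p. v c' = coord_change c c' p (v c)) \<and>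
        (\<forall>c. c \<notin> charts_at A p \<longrightarrow> v c = 0)}"

text \<open>The tangent vector at \<open>p\<close> with coordinate vector \<open>u\<close> in the chart \<open>c\<close>.\<close>

definition coord_vector :: "('a, 'e::real_inner) chart set \<Rightarrow> ('a, 'e) chart \<Rightarrow> 'a \<Rightarrow> 'e \<Rightarrow> ('a, 'e) tangent"
  where "coord_vector A c p u = (\<lambda>c'. if c' \<in> charts_at A p then coord_change c c' p u else 0)"

section \<open>Differential forms\<close>

text \<open>An \<open>r\<close>-form on an open set \<open>W\<close> assigns to each \<open>p \<in> W\<close> an alternating \<open>r\<close>-linear form on
  the tangent space at \<open>p\<close>, applied to a list of \<open>r\<close> tangent vectors. Outside this domain its
  value is \<open>0\<close>, so that equality of forms is equality of functions. As \<open>W\<close> is open, its tangent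
  spaces are those of the manifold, and its charts the restrictions of the charts in \<open>A\<close>.\<close>

type_synonym ('a, 'e) form = "'a \<Rightarrow> ('a, 'e) tangent list \<Rightarrow> real"

definition alternating_form :: "'v::real_vector set \<Rightarrow> nat \<Rightarrow> ('v list \<Rightarrow> real) \<Rightarrow> bool"
  where "alternating_form T r \<alpha> \<longleftrightarrow>
    (\<forall>vs. \<not> (length vs = r \<and> set vs \<subseteq> T) \<longrightarrow> \<alpha> vs = 0) \<and>
    (\<forall>vs i v w a b. length vs = r \<and> set vs \<subseteq> T \<and> i < r \<and> v \<in> T \<and> w \<in> T \<longrightarrow>
       \<alpha> (vs[i := a *\<^sub>R v + b *\<^sub>R w]) = a * \<alpha> (vs[i := v]) + b * \<alpha> (vs[i := w])) \<and>
    (\<forall>vs i j. length vs = r \<and> set vs \<subseteq> T \<and> i < j \<and> j < r \<and> vs ! i = vs ! j \<longrightarrow> \<alpha> vs = 0)"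

definition local_rep ::
    "('a, 'e::real_inner) chart set \<Rightarrow> ('a, 'e) chart \<Rightarrow> ('a, 'e) form \<Rightarrow> 'e \<Rightarrow> 'e list \<Rightarrow> real"
  where "local_rep A c \<omega> x us = \<omega> (chart_inv c x) (map (coord_vector A c (chart_inv c x)) us)"

definition forms :: "('a, 'e::real_inner) chart set \<Rightarrow> 'a set \<Rightarrow> nat \<Rightarrow> ('a, 'e) form set"
  where "forms A W r =
    {\<omega>. (\<forall>p\<in>W. alternating_form (tangent_space A p) r (\<omega> p)) \<and>
        (\<forall>p. p \<notin> W \<longrightarrow> \<omega> p = 0) \<and>
        (\<forall>c\<in>A. \<forall>us. length us = r \<longrightarrow>
           smooth_on (snd c ` (fst c \<inter> W)) (\<lambda>x. local_rep A c \<omega> x us))}"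

definition fun_form :: "'a set \<Rightarrow> ('a \<Rightarrow> real) \<Rightarrow> ('a, 'e::real_inner) form"
  where "fun_form W f p vs = (if p \<in> W \<and> vs = [] then f p else 0)"

definition fun_mult :: "('a \<Rightarrow> real) \<Rightarrow> ('a, 'e::real_inner) form \<Rightarrow> ('a, 'e) form"
  where "fun_mult f \<omega> = (\<lambda>p. f p *\<^sub>R \<omega> p)"

abbreviation omit :: "nat \<Rightarrow> 'v list \<Rightarrow> 'v list"
  where "omit i vs \<equiv> take i vs @ drop (Suc i) vs"

text \<open>The exterior product with a 1-form on the left, in the normalization for which
  \<open>d (f \<omega>) = df \<and> \<omega> + f d\<omega>\<close>.\<close>

definition wedge1 :: "('a, 'e::real_inner) form \<Rightarrow> ('a, 'e) form \<Rightarrow> ('a, 'e) form"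
  where "wedge1 \<theta> \<omega> p vs = (\<Sum>i<length vs. (-1) ^ i * \<theta> p [vs ! i] * \<omega> p (omit i vs))"

text \<open>The exterior derivative at \<open>p\<close> is computed in some chart around \<open>p\<close>; the result does not
  depend on that chart.\<close>

definition ext_d :: "('a, 'e::real_inner) chart set \<Rightarrow> 'a set \<Rightarrow> nat \<Rightarrow> ('a, 'e) form \<Rightarrow> ('a, 'e) form"
  where "ext_d A W r \<omega> p vs =
    (if p \<in> W \<and> length vs = Suc r \<and> set vs \<subseteq> tangent_space A p then
       let c = (SOME c. c \<in> charts_at A p); us = map (\<lambda>v. v c) vs in
       (\<Sum>i\<le>r. (-1) ^ i *
          frechet_derivative (\<lambda>x. local_rep A c \<omega> x (omit i us)) (at (snd c p)) (us ! i))
     else 0)"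

section \<open>Cohomology\<close>

definition cocycles :: "(nat \<Rightarrow> 'v::real_vector set) \<Rightarrow> (nat \<Rightarrow> 'v \<Rightarrow> 'v) \<Rightarrow> nat \<Rightarrow> 'v set"
  where "cocycles \<Omega> d r = {\<omega> \<in> \<Omega> r. d r \<omega> = 0}"

definition coboundaries :: "(nat \<Rightarrow> 'v::real_vector set) \<Rightarrow> (nat \<Rightarrow> 'v \<Rightarrow> 'v) \<Rightarrow> nat \<Rightarrow> 'v set"
  where "coboundaries \<Omega> d r = (case r of 0 \<Rightarrow> {0} | Suc k \<Rightarrow> d k ` \<Omega> k)"

definition quotient_space :: "'v::real_vector set \<Rightarrow> 'v set \<Rightarrow> 'v set set"
  where "quotient_space Z B = Z // {(x, y) \<in> Z \<times> Z. x - y \<in> B}"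

definition coset_add :: "'v::real_vector set \<Rightarrow> 'v set \<Rightarrow> 'v set"
  where "coset_add P Q = {x + y | x y. x \<in> P \<and> y \<in> Q}"

text \<open>The summand from \<open>B\<close> is needed for \<open>c = 0\<close>, where the result is the coset \<open>B\<close>.\<close>

definition coset_scale :: "'v::real_vector set \<Rightarrow> real \<Rightarrow> 'v set \<Rightarrow> 'v set"
  where "coset_scale B c P = {c *\<^sub>R x + b | x b. x \<in> P \<and> b \<in> B}"

definition isomorphic_quotients ::
    "'v::real_vector set \<Rightarrow> 'v set \<Rightarrow> 'w::real_vector set \<Rightarrow> 'w set \<Rightarrow> bool"
  where "isomorphic_quotients Z B Z' B' \<longleftrightarrow>
    (\<exists>h. bij_betw h (quotient_space Z B) (quotient_space Z' B') \<and>
         (\<forall>P\<in>quotient_space Z B. \<forall>Q\<in>quotient_space Z B.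
            h (coset_add P Q) = coset_add (h P) (h Q)) \<and>
         (\<forall>c. \<forall>P\<in>quotient_space Z B. h (coset_scale B c P) = coset_scale B' c (h P)))"

definition isomorphic_cohomology ::
    "(nat \<Rightarrow> 'v::real_vector set) \<Rightarrow> (nat \<Rightarrow> 'v \<Rightarrow> 'v) \<Rightarrow>
     (nat \<Rightarrow> 'w::real_vector set) \<Rightarrow> (nat \<Rightarrow> 'w \<Rightarrow> 'w) \<Rightarrow> bool"
  where "isomorphic_cohomology \<Omega> d \<Omega>' d' \<longleftrightarrow>
    (\<forall>r. isomorphic_quotients (cocycles \<Omega> d r) (coboundaries \<Omega> d r)
           (cocycles \<Omega>' d' r) (coboundaries \<Omega>' d' r))"

section \<open>The two complexes\<close>

definition zero_set :: "'a topology \<Rightarrow> ('a \<Rightarrow> real) \<Rightarrow> 'a set"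
  where "zero_set X f = {p \<in> topspace X. f p = 0}"

definition singular_forms ::
    "'a topology \<Rightarrow> ('a, 'e::real_inner) chart set \<Rightarrow> ('a \<Rightarrow> real) \<Rightarrow> nat \<Rightarrow> ('a, 'e) form set"
  where "singular_forms X A f r =
    {\<phi> \<in> forms A (topspace X - zero_set X f) r.
       \<exists>\<psi> \<in> forms A (topspace X) r.
         \<forall>p \<in> topspace X - zero_set X f. \<psi> p = fun_mult (\<lambda>q. f q ^ r) \<phi> p}"

definition d_theta ::
    "('a, 'e::real_inner) chart set \<Rightarrow> 'a set \<Rightarrow> ('a, 'e) form \<Rightarrow> nat \<Rightarrow> ('a, 'e) form \<Rightarrow> ('a, 'e) form"
  where "d_theta A W \<theta> r \<phi> = ext_d A W r \<phi> - wedge1 \<theta> \<phi>"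

definition d_f ::
    "'a topology \<Rightarrow> ('a, 'e::real_inner) chart set \<Rightarrow> ('a \<Rightarrow> real) \<Rightarrow> nat \<Rightarrow> ('a, 'e) form \<Rightarrow> ('a, 'e) form"
  where "d_f X A f r \<phi> =
    fun_mult f (ext_d A (topspace X) r \<phi>)
    - real r *\<^sub>R wedge1 (ext_d A (topspace X) 0 (fun_form (topspace X) f)) \<phi>"

definition d_f_theta ::
    "'a topology \<Rightarrow> ('a, 'e::real_inner) chart set \<Rightarrow> ('a \<Rightarrow> real) \<Rightarrow> ('a, 'e) form \<Rightarrow> nat \<Rightarrow>
     ('a, 'e) form \<Rightarrow> ('a, 'e) form"
  where "d_f_theta X A f \<theta> r \<phi> = d_f X A f r \<phi> - wedge1 (fun_mult f \<theta>) \<phi>"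

end

(*
  Let W be the complement of S. Since W is dense, a singular r-form phi determines the smooth
  extension psi of f^r phi, so psi |-> psi / f^r is a linear bijection from the smooth r-forms on M
  onto the singular r-forms. By the Leibniz rule,
    d_theta (psi / f^r) = (f d psi - r df wedge psi - f theta wedge psi) / f^(r+1),
  so this bijection intertwines the differentials and carries cocycles to cocycles and coboundaries
  to coboundaries. The analytic content is that d_{f,theta} psi is continuous, so that it vanishes as
  soon as it does on W. Near a given point this requires computing d psi in one fixed chart, hence
  the independence of d of the chart.
*)
theory Submission
  imports Defs
begin

section \<open>Continuously differentiable functions\<close>

text \<open>The obstacle is that \<open>ext_d\<close> evaluates at each point in a chart picked by
  \<open>SOME\<close>, and nothing relates the picks at neighbouring points, so that even continuity
  of d omega cannot be read off its definition. Under a transition map tau the arguments of the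
  pulled-back form are the moving vectors D tau (u). Differentiating them calls for a Leibniz rule
  for multilinear forms with moving arguments, and produces terms in D^2 tau, which the alternating
  sum kills by symmetry. The model space has a finite spanning set but no distinguished basis; an
  orthogonalized spanning set provides coordinates that are explicit inner products. The comparison
  takes place in the vector space of continuous forms, which contains the smooth forms as well as
  the values of d_{f,theta}. Density makes division by a power of f injective there. This is used
  twice: in degree r+1 to identify the cocycles, and in degree r to recover cosets of forms from
  their images.\<close>

lemma frechet_derivative_cong:
  assumes "open S" "x \<in> S" "\<And>y. y \<in> S \<Longrightarrow> g y = h y"
  shows "frechet_derivative g (at x) = frechet_derivative h (at x)"
proof -
  \<comment> \<open>Both functions have the same set of derivatives at \<open>x\<close>, so the
    choice operator inside \<open>frechet_derivative\<close> returns the same value, even if that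
    set is empty.\<close>
  have "(g has_derivative D) (at x) \<longleftrightarrow> (h has_derivative D) (at x)" for D
    using has_derivative_transform_within_open[OF _ assms(1,2)] assms(3) by metis
  then show ?thesis by (simp add: frechet_derivative_def)
qed

lemma differentiable_cong:
  assumes "open S" "x \<in> S" "\<And>y. y \<in> S \<Longrightarrow> g y = h y" "g differentiable (at x)"
  shows "h differentiable (at x)"
  using has_derivative_transform_within_open[OF _ assms(1,2)] assms(3,4)
  unfolding differentiable_def by metis

lemma cont_diff_on_cong:
  assumes "open S" "\<And>x. x \<in> S \<Longrightarrow> g x = h x" "cont_diff_on n S g"
  shows "cont_diff_on n S h"
  using assms(2,3)
proof (induction n arbitrary: g h)
  case 0
  then show ?case by (metis cont_diff_on.simps(1) continuous_on_eq)
next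
  case (Suc n)
  have "h differentiable (at x)" if "x \<in> S" for x
    using differentiable_cong[OF assms(1) that Suc.prems(1)] Suc.prems(2) that by simp
  moreover have "cont_diff_on n S (\<lambda>x. frechet_derivative h (at x) v)" for v
    using Suc.IH[of "\<lambda>x. frechet_derivative g (at x) v" "\<lambda>x. frechet_derivative h (at x) v"]
      frechet_derivative_cong[OF assms(1) _ Suc.prems(1)] Suc.prems(2)
    by auto
  ultimately show ?case by simp
qed

lemma cont_diff_on_subset:
  "cont_diff_on n S g \<Longrightarrow> T \<subseteq> S \<Longrightarrow> cont_diff_on n T g"
  by (induction n arbitrary: g) (auto intro: continuous_on_subset)

lemma cont_diff_on_SucD: "cont_diff_on (Suc n) S g \<Longrightarrow> cont_diff_on n S g"
proof (induction n arbitrary: g)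
  case 0
  then show ?case
    by (auto intro!: continuous_at_imp_continuous_on differentiable_imp_continuous_within)
next
  case (Suc n)
  then show ?case by (metis cont_diff_on.simps(2))
qed

lemma cont_diff_on_add:
  assumes "open S" "cont_diff_on n S g" "cont_diff_on n S h"
  shows "cont_diff_on n S (\<lambda>x. g x + h x)"
  using assms(2,3)
proof (induction n arbitrary: g h)
  case 0
  then show ?case by (simp add: continuous_on_add)
next
  case (Suc n)
  have D: "((\<lambda>x. g x + h x) has_derivative
      (\<lambda>v. frechet_derivative g (at x) v + frechet_derivative h (at x) v)) (at x)" if "x \<in> S" for x
    using Suc.prems that by (intro has_derivative_add) (auto simp: frechet_derivative_works)
  have "cont_diff_on n S (\<lambda>x. frechet_derivative (\<lambda>x. g x + h x) (at x) v)" for v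
    by (rule cont_diff_on_cong[OF assms(1), where g =
        "\<lambda>x. frechet_derivative g (at x) v + frechet_derivative h (at x) v"])
      (use Suc D in \<open>auto simp: frechet_derivative_at[OF D, symmetric]\<close>)
  then show ?case using D by (auto simp: differentiable_def)
qed

text \<open>The product rule brings back the undifferentiated factors, whose order
  \<open>cont_diff_on_SucD\<close> lowers to \<open>n\<close>. The induction hypothesis must hold
  for all pairs of factors, as each summand is a product of a new pair.\<close>

lemma cont_diff_on_mult:
  fixes g h :: "'e::real_normed_vector \<Rightarrow> real"
  assumes "open S" "cont_diff_on n S g" "cont_diff_on n S h"
  shows "cont_diff_on n S (\<lambda>x. g x * h x)"
  using assms(2,3)
proof (induction n arbitrary: g h)
  case 0
  then show ?case by (simp add: continuous_on_mult)
next
  case (Suc n)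
  have D: "((\<lambda>x. g x * h x) has_derivative
      (\<lambda>v. g x * frechet_derivative h (at x) v + frechet_derivative g (at x) v * h x)) (at x)"
    if "x \<in> S" for x
    using Suc.prems that by (intro has_derivative_mult) (auto simp: frechet_derivative_works)
  have "cont_diff_on n S (\<lambda>x. frechet_derivative (\<lambda>x. g x * h x) (at x) v)" for v
    by (rule cont_diff_on_cong[OF assms(1), where g =
        "\<lambda>x. g x * frechet_derivative h (at x) v + frechet_derivative g (at x) v * h x"])
      (use Suc D in \<open>auto simp: frechet_derivative_at[OF D, symmetric]
        intro!: cont_diff_on_add[OF assms(1)] Suc.IH
        intro: cont_diff_on_SucD[OF Suc.prems(1)] cont_diff_on_SucD[OF Suc.prems(2)]\<close>)
  then show ?case using D by (auto simp: differentiable_def)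
qed

lemma cont_diff_on_const: "cont_diff_on n S (\<lambda>x. c)"
  by (induction n arbitrary: c) (auto simp: frechet_derivative_const)

text \<open>A bootstrap: the derivative of 1/g is a product of 1/g, which has order \<open>n\<close>
  by induction, with a derivative of \<open>g\<close>. The function \<open>g\<close> stays fixed
  throughout.\<close>

lemma cont_diff_on_inverse:
  fixes g :: "'e::real_normed_vector \<Rightarrow> real"
  assumes "open S" "\<And>x. x \<in> S \<Longrightarrow> g x \<noteq> 0" "cont_diff_on n S g"
  shows "cont_diff_on n S (\<lambda>x. inverse (g x))"
  using assms(3)
proof (induction n)
  case 0
  then show ?case using assms(2) by (simp add: continuous_on_inverse)
next
  case (Suc n)
  have D: "((\<lambda>x. inverse (g x)) has_derivative
      (\<lambda>v. - (inverse (g x) * frechet_derivative g (at x) v * inverse (g x)))) (at x)"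
    if "x \<in> S" for x
    using Suc.prems that assms(2) by (intro Deriv.has_derivative_inverse) (auto simp: frechet_derivative_works)
  have "cont_diff_on n S (\<lambda>x. frechet_derivative (\<lambda>x. inverse (g x)) (at x) v)" for v
  proof (rule cont_diff_on_cong[OF assms(1)])
    show "cont_diff_on n S
        (\<lambda>x. (- 1) * (inverse (g x) * frechet_derivative g (at x) v * inverse (g x)))"
      using Suc cont_diff_on_SucD[OF Suc.prems]
      by (intro cont_diff_on_mult[OF assms(1)] cont_diff_on_const) auto
  qed (simp add: frechet_derivative_at[OF D, symmetric])
  then show ?case using D by (auto simp: differentiable_def)
qed

lemma cont_diff_on_power:
  fixes g :: "'e::real_normed_vector \<Rightarrow> real"
  assumes "open S" "cont_diff_on n S g"
  shows "cont_diff_on n S (\<lambda>x. g x ^ k)"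
  by (induction k) (auto intro: cont_diff_on_const cont_diff_on_mult assms)

lemma smooth_on_cong:
  assumes "open S" "\<And>x. x \<in> S \<Longrightarrow> g x = h x" "smooth_on S g"
  shows "smooth_on S h"
  using cont_diff_on_cong[OF assms(1,2)] assms(3) by (simp add: smooth_on_def)

lemma smooth_on_imp_continuous_on: "smooth_on S g \<Longrightarrow> continuous_on S g"
  by (metis smooth_on_def cont_diff_on.simps(1))

lemma smooth_on_has_derivative:
  "smooth_on S g \<Longrightarrow> x \<in> S \<Longrightarrow> (g has_derivative frechet_derivative g (at x)) (at x)"
  by (metis smooth_on_def cont_diff_on.simps(2) frechet_derivative_works)

lemma smooth_on_frechet_derivative:
  "smooth_on S g \<Longrightarrow> smooth_on S (\<lambda>x. frechet_derivative g (at x) v)"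
  by (metis smooth_on_def cont_diff_on.simps(2))

section \<open>Symmetry of second derivatives\<close>

text \<open>Two applications of the mean value theorem, in direction \<open>u\<close> and then in
  direction \<open>v\<close>, turn the difference quotient into the exact value of the mixed
  derivative at an intermediate point. That point tends to \<open>x\<close>, and continuity of the
  mixed derivative gives the limit.\<close>

lemma second_difference_tendsto:
  fixes F :: "'e::real_normed_vector \<Rightarrow> real"
  assumes S: "open S" "x \<in> S"
    and F: "\<And>y. y \<in> S \<Longrightarrow> (F has_derivative F' y) (at y)"
    and G: "\<And>y. y \<in> S \<Longrightarrow> ((\<lambda>y. F' y u) has_derivative G y) (at y)"
    and cont: "continuous_on S (\<lambda>y. G y v)"
  shows "((\<lambda>t. (F (x + t *\<^sub>R u + t *\<^sub>R v) - F (x + t *\<^sub>R u) - F (x + t *\<^sub>R v) + F x) / t\<^sup>2)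
    \<longlongrightarrow> G x v) (at_right 0)"
proof (rule tendstoI)
  fix \<epsilon> :: real assume "\<epsilon> > 0"
  obtain \<delta>1 where \<delta>1: "\<delta>1 > 0" "ball x \<delta>1 \<subseteq> S"
    using S open_contains_ball by blast
  obtain \<delta>2 where \<delta>2: "\<delta>2 > 0" "\<And>y. y \<in> S \<Longrightarrow> dist y x < \<delta>2 \<Longrightarrow> dist (G y v) (G x v) < \<epsilon>"
    using cont S(2) \<open>\<epsilon> > 0\<close> unfolding continuous_on_iff by metis
  define \<delta> where "\<delta> = min \<delta>1 \<delta>2"
  \<comment> \<open>For \<open>t < \<delta> / N\<close> the whole parallelogram with sides
    \<open>t *\<^sub>R u\<close> and \<open>t *\<^sub>R v\<close> lies in the ball of radius
    \<open>\<delta>\<close>. The summand 1 keeps \<open>N\<close> positive when both vectors are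
    0.\<close>
  define N where "N = norm u + norm v + 1"
  have N: "N > 0" by (simp add: N_def add_nonneg_pos)
  have near: "x + a *\<^sub>R u + b *\<^sub>R v \<in> S \<and> dist (G (x + a *\<^sub>R u + b *\<^sub>R v) v) (G x v) < \<epsilon>"
    if "0 \<le> a" "a \<le> t" "0 \<le> b" "b \<le> t" "t < \<delta> / N" for a b t
  proof -
    have "norm (a *\<^sub>R u + b *\<^sub>R v) \<le> a * norm u + b * norm v"
      using norm_triangle_ineq[of "a *\<^sub>R u" "b *\<^sub>R v"] that by simp
    also have "\<dots> \<le> t * norm u + t * norm v"
      using that by (intro add_mono mult_right_mono) auto
    also have "\<dots> \<le> t * N"
      using that by (simp add: N_def distrib_left)
    also have "\<dots> < \<delta>" using that N by (simp add: pos_less_divide_eq)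
    finally have "dist (x + a *\<^sub>R u + b *\<^sub>R v) x < \<delta>"
      by (simp add: dist_norm add.assoc)
    then show ?thesis using \<delta>1 \<delta>2(2)[of "x + a *\<^sub>R u + b *\<^sub>R v"] by (auto simp: \<delta>_def dist_commute subset_iff)
  qed
  have "dist ((F (x + t *\<^sub>R u + t *\<^sub>R v) - F (x + t *\<^sub>R u) - F (x + t *\<^sub>R v) + F x) / t\<^sup>2) (G x v) < \<epsilon>"
    if t: "0 < t" "t < \<delta> / N" for t
  proof -
    have DF: "((\<lambda>s. F (x + s *\<^sub>R u + b *\<^sub>R v)) has_real_derivative F' (x + s *\<^sub>R u + b *\<^sub>R v) u) (at s)"
      if "0 \<le> s" "s \<le> t" "0 \<le> b" "b \<le> t" for s b
    proof -
      have "x + s *\<^sub>R u + b *\<^sub>R v \<in> S" using near[of s t b] that t by blast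
      note y = this
      then have "((\<lambda>s. F (x + s *\<^sub>R u + b *\<^sub>R v)) has_derivative (\<lambda>h. F' (x + s *\<^sub>R u + b *\<^sub>R v) (h *\<^sub>R u))) (at s)"
        by (intro has_derivative_compose[OF _ F]) (auto intro!: derivative_eq_intros)
      moreover have "F' (x + s *\<^sub>R u + b *\<^sub>R v) (h *\<^sub>R u) = F' (x + s *\<^sub>R u + b *\<^sub>R v) u * h" for h
        using F[OF y] by (simp add: has_derivative_linear linear_cmul mult.commute)
      ultimately show ?thesis
        by (simp add: has_field_derivative_def)
    qed
    have DG: "((\<lambda>b. F' (x + s *\<^sub>R u + b *\<^sub>R v) u) has_real_derivative G (x + s *\<^sub>R u + b *\<^sub>R v) v) (at b)"
      if "0 \<le> s" "s \<le> t" "0 \<le> b" "b \<le> t" for s b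
    proof -
      have "x + s *\<^sub>R u + b *\<^sub>R v \<in> S" using near[of s t b] that t by blast
      note y = this
      then have "((\<lambda>b. F' (x + s *\<^sub>R u + b *\<^sub>R v) u) has_derivative (\<lambda>h. G (x + s *\<^sub>R u + b *\<^sub>R v) (h *\<^sub>R v))) (at b)"
        by (intro has_derivative_compose[OF _ G]) (auto intro!: derivative_eq_intros)
      moreover have "G (x + s *\<^sub>R u + b *\<^sub>R v) (h *\<^sub>R v) = G (x + s *\<^sub>R u + b *\<^sub>R v) v * h" for h
        using G[OF y] by (simp add: has_derivative_linear linear_cmul mult.commute)
      ultimately show ?thesis
        by (simp add: has_field_derivative_def)
    qed
    \<comment> \<open>The mean value theorem for s |-> F(x + su + tv) - F(x + su). The zero
      multiples remain visible so that \<open>DF\<close> matches with b = 0.\<close>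
    have "\<exists>\<xi>. 0 < \<xi> \<and> \<xi> < t \<and>
      (F (x + t *\<^sub>R u + t *\<^sub>R v) - F (x + t *\<^sub>R u + 0 *\<^sub>R v)) -
      (F (x + 0 *\<^sub>R u + t *\<^sub>R v) - F (x + 0 *\<^sub>R u + 0 *\<^sub>R v)) =
      (t - 0) * (F' (x + \<xi> *\<^sub>R u + t *\<^sub>R v) u - F' (x + \<xi> *\<^sub>R u + 0 *\<^sub>R v) u)"
      using t by (intro MVT2) (auto intro!: DERIV_diff DF simp del: scaleR_zero_left)
    then obtain \<xi> where \<xi>: "0 < \<xi>" "\<xi> < t"
      "F (x + t *\<^sub>R u + t *\<^sub>R v) - F (x + t *\<^sub>R u) - F (x + t *\<^sub>R v) + F x =
       t * (F' (x + \<xi> *\<^sub>R u + t *\<^sub>R v) u - F' (x + \<xi> *\<^sub>R u + 0 *\<^sub>R v) u)"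
      by auto
    \<comment> \<open>Now for b |-> F'(x + \<xi>u + bv) u, with \<xi> fixed.\<close>
    have "\<exists>\<eta>. 0 < \<eta> \<and> \<eta> < t \<and>
      F' (x + \<xi> *\<^sub>R u + t *\<^sub>R v) u - F' (x + \<xi> *\<^sub>R u + 0 *\<^sub>R v) u =
      (t - 0) * G (x + \<xi> *\<^sub>R u + \<eta> *\<^sub>R v) v"
      using t \<xi> by (intro MVT2) (auto intro!: DG simp del: scaleR_zero_left)
    then obtain \<eta> where \<eta>: "0 < \<eta>" "\<eta> < t"
      "F' (x + \<xi> *\<^sub>R u + t *\<^sub>R v) u - F' (x + \<xi> *\<^sub>R u + 0 *\<^sub>R v) u = t * G (x + \<xi> *\<^sub>R u + \<eta> *\<^sub>R v) v"
      by auto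
    have "dist (G (x + \<xi> *\<^sub>R u + \<eta> *\<^sub>R v) v) (G x v) < \<epsilon>"
      using near[of \<xi> t \<eta>] \<xi> \<eta> t by simp
    then show ?thesis
      using t unfolding \<xi>(3) \<eta>(3) by (simp add: power2_eq_square)
  qed
  moreover have "\<delta> / N > 0" using \<delta>1 \<delta>2 N by (simp add: \<delta>_def)
  ultimately show "\<forall>\<^sub>F t in at_right 0. dist ((F (x + t *\<^sub>R u + t *\<^sub>R v) - F (x + t *\<^sub>R u) -
      F (x + t *\<^sub>R v) + F x) / t\<^sup>2) (G x v) < \<epsilon>"
    using eventually_at_right_field by blast
qed

text \<open>The second difference is symmetric in \<open>u\<close> and \<open>v\<close>, so both
  mixed derivatives are limits of the same quotient. The mean value theorem is scalar, which is why
  \<open>g\<close> is paired with an arbitrary vector \<open>w\<close> before the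
  comparison.\<close>

lemma second_derivative_symmetric:
  fixes g :: "'e::real_normed_vector \<Rightarrow> 'b::real_inner"
  assumes S: "open S" "x \<in> S" and g: "cont_diff_on 2 S g"
  shows "frechet_derivative (\<lambda>y. frechet_derivative g (at y) u) (at x) v =
    frechet_derivative (\<lambda>y. frechet_derivative g (at y) v) (at x) u"
proof (rule vector_eq_rdot[THEN iffD1], rule allI)
  fix w :: 'b
  define F where "F y = g y \<bullet> w" for y
  define F' where "F' y u = frechet_derivative g (at y) u \<bullet> w" for y u
  define G where "G u y v = frechet_derivative (\<lambda>y. frechet_derivative g (at y) u) (at y) v \<bullet> w" for u y v
  have g2: "\<forall>y\<in>S. g differentiable (at y)"
    "\<And>u. \<forall>y\<in>S. (\<lambda>y. frechet_derivative g (at y) u) differentiable (at y)"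
    "\<And>u v. continuous_on S (\<lambda>y. frechet_derivative (\<lambda>y. frechet_derivative g (at y) u) (at y) v)"
    using g by (auto simp: numeral_2_eq_2)
  have dF: "(F has_derivative F' y) (at y)" if "y \<in> S" for y
    unfolding F_def F'_def using g2(1) that
    by (intro has_derivative_inner_left) (auto simp: frechet_derivative_works)
  have dG: "((\<lambda>y. F' y u) has_derivative G u y) (at y)" if "y \<in> S" for y u
    unfolding F'_def G_def using g2(2) that
    by (intro has_derivative_inner_left) (auto simp: frechet_derivative_works)
  have cG: "continuous_on S (\<lambda>y. G u y v)" for u v
    unfolding G_def using g2(3) by (intro continuous_on_inner) auto
  have "((\<lambda>t. (F (x + t *\<^sub>R u + t *\<^sub>R v) - F (x + t *\<^sub>R u) - F (x + t *\<^sub>R v) + F x) / t\<^sup>2)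
    \<longlongrightarrow> G u x v) (at_right 0)"
    by (rule second_difference_tendsto[OF S dF dG cG])
  moreover have "((\<lambda>t. (F (x + t *\<^sub>R u + t *\<^sub>R v) - F (x + t *\<^sub>R u) - F (x + t *\<^sub>R v) + F x) / t\<^sup>2)
    \<longlongrightarrow> G v x u) (at_right 0)"
    using second_difference_tendsto[OF S dF dG cG, of v u] by (simp add: algebra_simps)
  ultimately have "G u x v = G v x u"
    by (rule tendsto_unique[rotated]) simp
  then show "frechet_derivative (\<lambda>y. frechet_derivative g (at y) u) (at x) v \<bullet> w =
      frechet_derivative (\<lambda>y. frechet_derivative g (at y) v) (at x) u \<bullet> w"
    by (simp add: G_def)
qed

section \<open>Alternating multilinear forms\<close>

lemma alternating_form_eq_0:
  "alternating_form T r \<alpha> \<Longrightarrow> \<not> (length vs = r \<and> set vs \<subseteq> T) \<Longrightarrow> \<alpha> vs = 0"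
  by (simp add: alternating_form_def)

lemma alternating_form_repeat:
  assumes "alternating_form T r \<alpha>" "i < j" "j < length vs" "vs ! i = vs ! j"
  shows "\<alpha> vs = 0"
proof (cases "length vs = r \<and> set vs \<subseteq> T")
  case True
  then show ?thesis
    using conjunct2[OF conjunct2[OF assms(1)[unfolded alternating_form_def]], rule_format, of vs i j] assms
    by simp
qed (rule alternating_form_eq_0[OF assms(1)])

lemma alternating_form_update:
  assumes "alternating_form T r \<alpha>" "length vs = r" "set vs \<subseteq> T" "i < r" "v \<in> T" "w \<in> T"
  shows "\<alpha> (vs[i := a *\<^sub>R v + b *\<^sub>R w]) = a * \<alpha> (vs[i := v]) + b * \<alpha> (vs[i := w])"
  using conjunct1[OF conjunct2[OF assms(1)[unfolded alternating_form_def]], rule_format, of vs i v w] assms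
  by simp

text \<open>Length and remaining entries are unrestricted: if one of them is wrong, all three values
  are the default 0, because the subspace \<open>T\<close> contains \<open>v\<close>,
  \<open>w\<close> and their combination. Rewriting with it therefore leaves no side conditions on
  lists.\<close>

lemma alternating_form_linear:
  fixes \<alpha> :: "'v::real_vector list \<Rightarrow> real"
  assumes \<alpha>: "alternating_form T r \<alpha>" and T: "subspace T" and vw: "v \<in> T" "w \<in> T"
  shows "\<alpha> (xs @ (a *\<^sub>R v + b *\<^sub>R w) # ys) = a * \<alpha> (xs @ v # ys) + b * \<alpha> (xs @ w # ys)"
proof (cases "length (xs @ v # ys) = r \<and> set (xs @ v # ys) \<subseteq> T")
  case True
  have "\<alpha> ((xs @ v # ys)[length xs := a *\<^sub>R v + b *\<^sub>R w]) =
      a * \<alpha> ((xs @ v # ys)[length xs := v]) + b * \<alpha> ((xs @ v # ys)[length xs := w])"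
    using True by (intro alternating_form_update[OF \<alpha> _ _ _ vw]) auto
  then show ?thesis by simp
next
  case False
  then show ?thesis
    using vw T alternating_form_eq_0[OF \<alpha>] by (auto simp: subspace_add subspace_scale)
qed

lemma alternating_form_add:
  fixes \<alpha> :: "'v::real_vector list \<Rightarrow> real"
  assumes "alternating_form T r \<alpha>" "subspace T" "v \<in> T" "w \<in> T"
  shows "\<alpha> (xs @ (v + w) # ys) = \<alpha> (xs @ v # ys) + \<alpha> (xs @ w # ys)"
  using alternating_form_linear[OF assms, of xs 1 1 ys] by simp

lemma alternating_form_sum:
  fixes \<alpha> :: "'v::real_vector list \<Rightarrow> real"
  assumes "alternating_form UNIV r \<alpha>" "finite B"
  shows "\<alpha> (xs @ (\<Sum>b\<in>B. k b *\<^sub>R b) # ys) = (\<Sum>b\<in>B. k b * \<alpha> (xs @ b # ys))"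
  using assms(2)
proof (induction B)
  case empty
  \<comment> \<open>A combination with both coefficients 0 shows that a zero entry makes the value
    0.\<close>
  show ?case using alternating_form_linear[OF assms(1) subspace_UNIV, of 0 0 xs 0 0 ys] by simp
next
  case (insert b B)
  then show ?case
    using alternating_form_linear[OF assms(1) subspace_UNIV, of b "\<Sum>b\<in>B. k b *\<^sub>R b" xs "k b" 1 ys] by simp
qed

lemma alternating_form_swap:
  fixes \<alpha> :: "'v::real_vector list \<Rightarrow> real"
  assumes \<alpha>: "alternating_form UNIV r \<alpha>"
  shows "\<alpha> (xs @ a # b # ys) = - \<alpha> (xs @ b # a # ys)"
proof -
  have z: "\<alpha> (xs @ c # c # ys) = 0" for c
    by (rule alternating_form_repeat[OF \<alpha>, of "length xs" "Suc (length xs)"])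
      (auto simp: nth_append)
  have "0 = \<alpha> (xs @ (a + b) # (a + b) # ys)" by (simp add: z)
  also have "\<dots> = \<alpha> (xs @ a # (a + b) # ys) + \<alpha> (xs @ b # (a + b) # ys)"
    by (simp add: alternating_form_add[OF \<alpha> subspace_UNIV])
  also have "\<dots> = \<alpha> (xs @ a # b # ys) + \<alpha> (xs @ b # a # ys)"
    using alternating_form_add[OF \<alpha> subspace_UNIV, of a b "xs @ [a]" ys]
      alternating_form_add[OF \<alpha> subspace_UNIV, of a b "xs @ [b]" ys]
    by (simp add: z)
  finally show ?thesis by simp
qed

text \<open>One adjacent transposition for each entry of \<open>ys\<close>; entries already passed
  are absorbed into \<open>xs\<close>, which is why it is generalized in the induction.\<close>

lemma alternating_form_move:
  fixes \<alpha> :: "'v::real_vector list \<Rightarrow> real"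
  assumes \<alpha>: "alternating_form UNIV r \<alpha>"
  shows "\<alpha> (xs @ a # ys @ zs) = (-1) ^ length ys * \<alpha> (xs @ ys @ a # zs)"
proof (induction ys arbitrary: xs)
  case (Cons y ys)
  show ?case
    using alternating_form_swap[OF \<alpha>, of xs a y "ys @ zs"] Cons[of "xs @ [y]"] by simp
qed simp

section \<open>Omitting one entry and substituting another\<close>

lemma length_omit: "i < length xs \<Longrightarrow> length (omit i xs) = length xs - 1"
  by simp

lemma map_omit: "map g (omit i xs) = omit i (map g xs)"
  by (simp add: take_map drop_map)

lemma nth_omit:
  "i < length xs \<Longrightarrow> j < length xs - 1 \<Longrightarrow> omit i xs ! j = xs ! (if j < i then j else Suc j)"
  by (auto simp: nth_append min_def)

text \<open>Position \<open>j\<close> of a list without its entry \<open>i\<close> is position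
  \<open>j\<close> or \<open>Suc j\<close> of the full list, as in \<open>nth_omit\<close>; this is
  a bijection onto the positions other than \<open>i\<close>.\<close>

lemma sum_omit_index:
  fixes F :: "nat \<Rightarrow> 'b::comm_monoid_add"
  assumes "i \<le> r"
  shows "(\<Sum>j<r. F (if j < i then j else Suc j)) = (\<Sum>k\<in>{..r} - {i}. F k)"
  by (rule sum.reindex_bij_witness[where i = "\<lambda>k. if k < i then k else k - 1"
        and j = "\<lambda>j. if j < i then j else Suc j"]) (use assms in auto)

text \<open>The terms for the pairs \<open>(i, k)\<close> and \<open>(k, i)\<close> of omitted and substituted positions cancel.\<close>

lemma alternating_form_symmetric_cancel:
  fixes \<alpha> :: "'v::real_vector list \<Rightarrow> real"
  assumes \<alpha>: "alternating_form UNIV r \<alpha>" and H: "\<And>u v. H u v = H v u" and us: "length us = Suc r"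
  shows "(\<Sum>i\<le>r. (-1) ^ i * (\<Sum>j<r. \<alpha> ((map T (omit i us))[j := H (us ! i) (omit i us ! j)]))) = 0"
proof -
  \<comment> \<open>The summand is indexed by the position \<open>k\<close> in the full list instead
    of the position in the shortened one, where it is \<open>k\<close> or \<open>k - 1\<close>. Only
    in this indexing can (i, k) and (k, i) be compared; the diagonal is filled with 0.\<close>
  define G where "G i k = (if i = k then 0 else (-1) ^ i *
    \<alpha> ((map T (omit i us))[(if k < i then k else k - 1) := H (us ! i) (us ! k)]))" for i k
  have anti: "G i k = - G k i" if ik: "i < k" "k \<le> r" for i k
  proof -
    define xs p ys q zs where "xs = take i us" and "p = us ! i"
      and "ys = take (k - Suc i) (drop (Suc i) us)" and "q = us ! k" and "zs = drop (Suc k) us"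
    have "drop (Suc i) us = ys @ drop k us"
      using ik by (simp add: ys_def) (metis Suc_leI append_take_drop_id drop_drop le_add_diff_inverse2)
    moreover have "us = take i us @ us ! i # drop (Suc i) us"
      using ik us by (intro id_take_nth_drop) simp
    moreover have "drop k us = us ! k # drop (Suc k) us"
      using ik us by (simp add: Cons_nth_drop_Suc)
    ultimately have dec: "us = xs @ p # ys @ q # zs"
      unfolding xs_def p_def q_def zs_def by metis
    have lxs: "length xs = i" and lys: "length ys = k - Suc i"
      using ik us by (auto simp: xs_def ys_def)
    have oi: "omit i us = xs @ ys @ q # zs" by (subst dec)+ (simp add: lxs)
    have ok: "omit k us = xs @ p # ys @ zs"
      using ik by (subst dec)+ (simp add: lxs lys take_Cons' drop_Cons')
    have "k - 1 = length (map T xs @ map T ys)"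
      using ik by (simp add: lxs lys)
    then have "(map T (omit i us))[k - 1 := h] = map T xs @ map T ys @ h # map T zs" for h
      unfolding oi map_append list.map append_assoc[symmetric] by (metis list_update_length)
    then have "G i k = (-1) ^ i * \<alpha> (map T xs @ map T ys @ H p q # map T zs)"
      using ik by (simp add: G_def p_def q_def del: map_append)
    moreover have "G k i = (-1) ^ k * \<alpha> (map T xs @ H q p # map T ys @ map T zs)"
      using ik by (simp add: G_def ok p_def[symmetric] q_def[symmetric] list_update_append lxs)
    \<comment> \<open>Both lists carry the same substituted vector, by symmetry of \<open>H\<close>,
      at positions i and k - 1. The move costs the sign (-1)^(k-i-1), and together with (-1)^k this
      is the opposite of (-1)^i.\<close>
    moreover have "\<alpha> (map T xs @ H q p # map T ys @ map T zs) =
        (-1) ^ (k - Suc i) * \<alpha> (map T xs @ map T ys @ H p q # map T zs)"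
      using alternating_form_move[OF \<alpha>, of "map T xs" "H q p" "map T ys" "map T zs"]
      by (simp add: lys H)
    moreover obtain n where n: "k = Suc (i + n)"
      using ik less_imp_Suc_add by blast
    moreover have "(-1::real) ^ n * (-1) ^ n = 1"
      by (simp flip: power_mult_distrib)
    ultimately show ?thesis by (simp add: power_add)
  qed
  have G_anti: "G i k = - G k i" if "i \<le> r" "k \<le> r" for i k
    using anti[of i k] anti[of k i] that by (cases i k rule: linorder_cases) (auto simp: G_def)
  have "(\<Sum>i\<le>r. (-1) ^ i * (\<Sum>j<r. \<alpha> ((map T (omit i us))[j := H (us ! i) (omit i us ! j)]))) =
      (\<Sum>i\<le>r. \<Sum>k\<le>r. G i k)"
  proof (rule sum.cong[OF refl])
    fix i assume i: "i \<in> {..r}"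
    have "(-1) ^ i * (\<Sum>j<r. \<alpha> ((map T (omit i us))[j := H (us ! i) (omit i us ! j)])) =
        (\<Sum>j<r. G i (if j < i then j else Suc j))"
      unfolding sum_distrib_left
      by (rule sum.cong) (use i us in \<open>auto simp: G_def nth_omit simp del: map_append\<close>)
    also have "\<dots> = (\<Sum>k\<in>{..r} - {i}. G i k)" using i by (intro sum_omit_index) simp
    also have "\<dots> = (\<Sum>k\<le>r. G i k)" using i by (intro sum.mono_neutral_left) (auto simp: G_def)
    finally show "(-1) ^ i * (\<Sum>j<r. \<alpha> ((map T (omit i us))[j := H (us ! i) (omit i us ! j)])) =
        (\<Sum>k\<le>r. G i k)" .
  qed
  also have "\<dots> = 0"
  proof -
    have "(\<Sum>i\<le>r. \<Sum>k\<le>r. G i k) = (\<Sum>i\<le>r. \<Sum>k\<le>r. - G k i)"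
      by (intro sum.cong refl G_anti) simp_all
    also have "\<dots> = - (\<Sum>i\<le>r. \<Sum>k\<le>r. G i k)"
      by (subst sum.swap) (simp add: sum_negf)
    finally show ?thesis by (rule equal_neg_zero[THEN iffD1])
  qed
  finally show ?thesis .
qed

section \<open>Derivatives of multilinear expressions in moving vectors\<close>

lemma orthogonal_expansion:
  fixes C :: "'e::real_inner set"
  assumes "finite C" "pairwise orthogonal C" "v \<in> span C"
  shows "v = (\<Sum>b\<in>C. (v \<bullet> b / (b \<bullet> b)) *\<^sub>R b)"
proof -
  define w where "w = v - (\<Sum>b\<in>C. (v \<bullet> b / (b \<bullet> b)) *\<^sub>R b)"
  have w: "w \<in> span C"
    unfolding w_def using assms(3) by (simp add: span_diff span_sum span_scale span_base)
  have "w \<bullet> c = 0" if c: "c \<in> C" for c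
  proof -
    \<comment> \<open>The set \<open>C\<close> may contain 0. Its coefficient is then 0 by the
      convention for division by zero, and the case b = c = 0 gives 0 on both sides.\<close>
    have "(\<Sum>b\<in>C. (v \<bullet> b / (b \<bullet> b)) *\<^sub>R b) \<bullet> c = (\<Sum>b\<in>C. if b = c then v \<bullet> c else 0)"
      unfolding inner_sum_left
      using assms(2) c by (intro sum.cong) (auto simp: pairwise_def orthogonal_def)
    then show ?thesis using c assms(1) by (simp add: w_def inner_diff_left)
  qed
  then have "orthogonal w x" if "x \<in> span C" for x
    using orthogonal_to_span[OF that] by (auto simp: orthogonal_def)
  then have "w \<bullet> w = 0" using w by (auto simp: orthogonal_def)
  then show ?thesis by (simp add: w_def)
qed

text \<open>The coefficients are explicit linear functions of \<open>v\<close>, so they can be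
  differentiated when \<open>v\<close> is replaced by a differentiable function.\<close>

lemma finite_span_expansion:
  assumes "\<exists>B::'e::real_inner set. finite B \<and> span B = UNIV"
  obtains C :: "'e::real_inner set" where "finite C"
    "\<And>v. v = (\<Sum>b\<in>C. (v \<bullet> b / (b \<bullet> b)) *\<^sub>R b)"
proof -
  obtain B :: "'e set" where "finite B" "span B = UNIV" using assms by blast
  with basis_orthogonal[of B] obtain C :: "'e set" where "finite C" "span C = UNIV" "pairwise orthogonal C"
    by auto
  then show ?thesis using orthogonal_expansion[of C] by (intro that[of C]) auto
qed

text \<open>The Leibniz rule for a multilinear form with varying arguments. The arguments in \<open>ws\<close> are
  frozen: expanding the last varying argument in a basis reduces the claim to basis vectors in its
  place, so that the induction moves arguments from \<open>gs\<close> to \<open>ws\<close>.\<close>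

lemma multilinear_has_derivative:
  fixes \<gamma> :: "'e::real_normed_vector \<Rightarrow> 'v::real_inner list \<Rightarrow> real"
  assumes fin: "\<exists>B::'v set. finite B \<and> span B = UNIV"
    and S: "open S" "x0 \<in> S"
    and alt: "\<And>x. x \<in> S \<Longrightarrow> alternating_form UNIV r (\<gamma> x)"
    and diff: "\<And>us. length us = r \<Longrightarrow> (\<lambda>x. \<gamma> x us) differentiable (at x0)"
    and gs: "\<And>g. g \<in> set gs \<Longrightarrow> (g has_derivative Dg g) (at x0)"
    and len: "length gs + length ws = r"
  shows "((\<lambda>x. \<gamma> x (map (\<lambda>g. g x) gs @ ws)) has_derivative
    (\<lambda>v. frechet_derivative (\<lambda>x. \<gamma> x (map (\<lambda>g. g x0) gs @ ws)) (at x0) v +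
      (\<Sum>j<length gs. \<gamma> x0 ((map (\<lambda>g. g x0) gs @ ws)[j := Dg (gs ! j) v])))) (at x0)"
proof -
  obtain C :: "'v set" where C: "finite C" "\<And>v. v = (\<Sum>b\<in>C. (v \<bullet> b / (b \<bullet> b)) *\<^sub>R b)"
    using finite_span_expansion[OF fin] by blast
  have expand: "\<gamma> x (xs @ v # ys) = (\<Sum>b\<in>C. (v \<bullet> b / (b \<bullet> b)) * \<gamma> x (xs @ b # ys))"
    if "x \<in> S" for x xs v ys
    using alternating_form_sum[OF alt[OF that] C(1)] C(2)[of v] by metis
  have D\<gamma>: "((\<lambda>x. \<gamma> x us) has_derivative frechet_derivative (\<lambda>x. \<gamma> x us) (at x0)) (at x0)"
    if "length us = r" for us
    using diff[OF that] by (simp add: frechet_derivative_works)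
  \<comment> \<open>The derivative of the form at frozen arguments is itself linear in each
    argument. This is what allows the expansion in \<open>C\<close> to be undone after
    differentiating.\<close>
  have expand_D: "frechet_derivative (\<lambda>x. \<gamma> x (xs @ v # ys)) (at x0) h =
      (\<Sum>b\<in>C. (v \<bullet> b / (b \<bullet> b)) * frechet_derivative (\<lambda>x. \<gamma> x (xs @ b # ys)) (at x0) h)"
    if "length (xs @ v # ys) = r" for xs v ys h
  proof -
    have "((\<lambda>x. \<Sum>b\<in>C. (v \<bullet> b / (b \<bullet> b)) * \<gamma> x (xs @ b # ys)) has_derivative
      (\<lambda>h. \<Sum>b\<in>C. (v \<bullet> b / (b \<bullet> b)) * frechet_derivative (\<lambda>x. \<gamma> x (xs @ b # ys)) (at x0) h)) (at x0)"
      using that by (intro has_derivative_sum has_derivative_mult_right D\<gamma>) auto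
    then have "((\<lambda>x. \<gamma> x (xs @ v # ys)) has_derivative
      (\<lambda>h. \<Sum>b\<in>C. (v \<bullet> b / (b \<bullet> b)) * frechet_derivative (\<lambda>x. \<gamma> x (xs @ b # ys)) (at x0) h)) (at x0)"
      by (rule has_derivative_transform_within_open[OF _ S]) (rule expand[symmetric])
    then show ?thesis by (rule fun_cong[OF frechet_derivative_at, symmetric])
  qed
  from gs len show ?thesis
  proof (induction gs arbitrary: ws rule: rev_induct)
    case Nil
    then show ?case using D\<gamma>[of ws] by simp
  next
    case (snoc g gs)
    define P where "P = map (\<lambda>g. g x0) gs"
    have lP: "length P = length gs" by (simp add: P_def)
    have Dgx: "(g has_derivative Dg g) (at x0)" using snoc.prems by simp
    have IH: "((\<lambda>x. \<gamma> x (map (\<lambda>g. g x) gs @ b # ws)) has_derivative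
        (\<lambda>v. frechet_derivative (\<lambda>x. \<gamma> x (P @ b # ws)) (at x0) v +
          (\<Sum>j<length gs. \<gamma> x0 ((P @ b # ws)[j := Dg (gs ! j) v])))) (at x0)" for b
      unfolding P_def using snoc.prems by (intro snoc.IH) auto
    have k: "((\<lambda>x. g x \<bullet> b / (b \<bullet> b)) has_derivative (\<lambda>v. Dg g v \<bullet> b / (b \<bullet> b))) (at x0)" for b
      unfolding divide_inverse by (intro has_derivative_mult_left has_derivative_inner_left Dgx)
    have "((\<lambda>x. \<Sum>b\<in>C. (g x \<bullet> b / (b \<bullet> b)) * \<gamma> x (map (\<lambda>g. g x) gs @ b # ws)) has_derivative
      (\<lambda>v. \<Sum>b\<in>C. (g x0 \<bullet> b / (b \<bullet> b)) *
          (frechet_derivative (\<lambda>x. \<gamma> x (P @ b # ws)) (at x0) v +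
          (\<Sum>j<length gs. \<gamma> x0 ((P @ b # ws)[j := Dg (gs ! j) v]))) +
          Dg g v \<bullet> b / (b \<bullet> b) * \<gamma> x0 (P @ b # ws))) (at x0)" (is "(_ has_derivative ?D) _")
      unfolding P_def by (intro has_derivative_sum has_derivative_mult k IH[unfolded P_def])
    then have main: "((\<lambda>x. \<gamma> x (map (\<lambda>g. g x) gs @ g x # ws)) has_derivative ?D) (at x0)"
      by (rule has_derivative_transform_within_open[OF _ S]) (rule expand[symmetric])
    have "?D v = frechet_derivative (\<lambda>x. \<gamma> x (P @ g x0 # ws)) (at x0) v +
        (\<Sum>j<length gs. \<gamma> x0 ((P @ g x0 # ws)[j := Dg (gs ! j) v])) + \<gamma> x0 (P @ Dg g v # ws)" for v
    proof -
      \<comment> \<open>A substitution at a position below \<open>length gs\<close> happens inside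
        \<open>P\<close> and leaves the next entry alone, so that entry can be expanded in
        \<open>C\<close> within every summand.\<close>
      have "(\<Sum>j<length gs. \<gamma> x0 ((P @ g x0 # ws)[j := Dg (gs ! j) v])) =
          (\<Sum>j<length gs. \<Sum>b\<in>C. (g x0 \<bullet> b / (b \<bullet> b)) * \<gamma> x0 ((P @ b # ws)[j := Dg (gs ! j) v]))"
        by (intro sum.cong refl) (simp add: list_update_append1 lP expand[OF S(2), of _ "g x0" ws])
      also have "\<dots> = (\<Sum>b\<in>C. (g x0 \<bullet> b / (b \<bullet> b)) * (\<Sum>j<length gs. \<gamma> x0 ((P @ b # ws)[j := Dg (gs ! j) v])))"
        by (subst sum.swap) (simp add: sum_distrib_left)
      finally have sum_eq: "(\<Sum>j<length gs. \<gamma> x0 ((P @ g x0 # ws)[j := Dg (gs ! j) v])) = \<dots>" .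
      have "length (P @ g x0 # ws) = r" using snoc.prems lP by simp
      then show ?thesis
        unfolding sum_eq expand[OF S(2), of P "Dg g v" ws] expand_D[OF \<open>length (P @ g x0 # ws) = r\<close>, of v]
        by (simp only: sum.distrib distrib_left add.assoc)
    qed
    then have D_eq: "?D = (\<lambda>v. frechet_derivative (\<lambda>x. \<gamma> x (map (\<lambda>g. g x0) (gs @ [g]) @ ws)) (at x0) v +
      (\<Sum>j<length (gs @ [g]). \<gamma> x0 ((map (\<lambda>g. g x0) (gs @ [g]) @ ws)[j := Dg ((gs @ [g]) ! j) v])))"
      by (simp add: fun_eq_iff nth_append list_update_append P_def[symmetric] lP)
    show ?case using has_derivative_eq_rhs[OF main D_eq] by simp
  qed
qed

text \<open>The coordinate expression of the exterior derivative commutes with the pullback along \<open>\<tau>\<close>: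
  the terms with second derivatives of \<open>\<tau>\<close> cancel because those are symmetric.\<close>

lemma coordinate_ext_d_pullback:
  fixes \<alpha> \<beta> :: "'e::real_inner \<Rightarrow> 'e list \<Rightarrow> real" and \<tau> :: "'e \<Rightarrow> 'e"
  assumes fin: "\<exists>B::'e set. finite B \<and> span B = UNIV"
    and S: "open S" "x0 \<in> S" and \<tau>: "cont_diff_on 2 S \<tau>"
    and pullback: "\<And>x us. x \<in> S \<Longrightarrow> length us = r \<Longrightarrow>
      \<alpha> x us = \<beta> (\<tau> x) (map (frechet_derivative \<tau> (at x)) us)"
    and alt: "\<And>x. x \<in> S \<Longrightarrow> alternating_form UNIV r (\<beta> (\<tau> x))"
    and diff: "\<And>us. length us = r \<Longrightarrow> (\<lambda>y. \<beta> y us) differentiable (at (\<tau> x0))"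
    and us: "length us = Suc r"
  shows "(\<Sum>i\<le>r. (-1) ^ i * frechet_derivative (\<lambda>x. \<alpha> x (omit i us)) (at x0) (us ! i)) =
    (\<Sum>i\<le>r. (-1) ^ i *
      frechet_derivative (\<lambda>y. \<beta> y (omit i (map (frechet_derivative \<tau> (at x0)) us))) (at (\<tau> x0))
        (map (frechet_derivative \<tau> (at x0)) us ! i))"
proof -
  define T where "T = frechet_derivative \<tau> (at x0)"
  define H where "H v u = frechet_derivative (\<lambda>x. frechet_derivative \<tau> (at x) u) (at x0) v" for v u
  have H: "H u v = H v u" for u v
    unfolding H_def by (rule second_derivative_symmetric[OF S \<tau>])
  have d\<tau>: "(\<tau> has_derivative T) (at x0)"
    using \<tau> S by (auto simp: T_def numeral_2_eq_2 frechet_derivative_works)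
  have d2\<tau>: "((\<lambda>x. frechet_derivative \<tau> (at x) u) has_derivative (\<lambda>v. H v u)) (at x0)" for u
    using \<tau> S by (auto simp: H_def numeral_2_eq_2 frechet_derivative_works)
  define D where "D ws = frechet_derivative (\<lambda>y. \<beta> y ws) (at (\<tau> x0))" for ws
  have d\<beta>: "((\<lambda>x. \<beta> (\<tau> x) ws) has_derivative (\<lambda>v. D ws (T v))) (at x0)" if "length ws = r" for ws
    using diff[OF that] unfolding D_def
    by (intro has_derivative_compose[OF d\<tau>]) (simp add: frechet_derivative_works)
  have step: "frechet_derivative (\<lambda>x. \<alpha> x ws) (at x0) v = D (map T ws) (T v) +
      (\<Sum>j<r. \<beta> (\<tau> x0) ((map T ws)[j := H v (ws ! j)]))" if ws: "length ws = r" for ws v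
  proof -
    define gs where "gs = map (\<lambda>u x. frechet_derivative \<tau> (at x) u) ws"
    define Dg where "Dg g v = frechet_derivative g (at x0) v" for g :: "'e \<Rightarrow> 'e" and v
    have "((\<lambda>x. \<beta> (\<tau> x) (map (\<lambda>g. g x) gs @ [])) has_derivative
      (\<lambda>v. frechet_derivative (\<lambda>x. \<beta> (\<tau> x) (map (\<lambda>g. g x0) gs @ [])) (at x0) v +
      (\<Sum>j<length gs. \<beta> (\<tau> x0) ((map (\<lambda>g. g x0) gs @ [])[j := Dg (gs ! j) v])))) (at x0)"
    proof (rule multilinear_has_derivative[OF fin S alt])
      show "(g has_derivative Dg g) (at x0)" if "g \<in> set gs" for g
        using that d2\<tau> by (auto simp: gs_def Dg_def[abs_def] frechet_derivative_works[symmetric] differentiable_def)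
    qed (use d\<beta> ws in \<open>auto simp: gs_def differentiable_def\<close>)
    then have "((\<lambda>x. \<beta> (\<tau> x) (map (frechet_derivative \<tau> (at x)) ws)) has_derivative
      (\<lambda>v. D (map T ws) (T v) + (\<Sum>j<r. \<beta> (\<tau> x0) ((map T ws)[j := H v (ws ! j)])))) (at x0)"
      using ws d\<beta>[of "map T ws", THEN frechet_derivative_at, symmetric]
      by (simp add: gs_def Dg_def H_def o_def T_def[symmetric])
    then have "((\<lambda>x. \<alpha> x ws) has_derivative
      (\<lambda>v. D (map T ws) (T v) + (\<Sum>j<r. \<beta> (\<tau> x0) ((map T ws)[j := H v (ws ! j)])))) (at x0)"
      by (rule has_derivative_transform_within_open[OF _ S]) (simp add: pullback ws)
    then show ?thesis by (rule fun_cong[OF frechet_derivative_at, symmetric])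
  qed
  have "(\<Sum>i\<le>r. (-1) ^ i * frechet_derivative (\<lambda>x. \<alpha> x (omit i us)) (at x0) (us ! i)) =
      (\<Sum>i\<le>r. (-1) ^ i * D (omit i (map T us)) (map T us ! i)) +
      (\<Sum>i\<le>r. (-1) ^ i * (\<Sum>j<r. \<beta> (\<tau> x0) ((map T (omit i us))[j := H (us ! i) (omit i us ! j)])))"
    unfolding sum.distrib[symmetric] distrib_left[symmetric]
    using us by (intro sum.cong refl arg_cong2[where f = "(*)"])
      (simp add: step map_omit length_omit del: map_append length_append)
  also have "(\<Sum>i\<le>r. (-1) ^ i * (\<Sum>j<r. \<beta> (\<tau> x0) ((map T (omit i us))[j := H (us ! i) (omit i us ! j)]))) = 0"
    by (rule alternating_form_symmetric_cancel[OF alt[OF S(2)] H us])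
  finally show ?thesis by (simp add: T_def D_def)
qed

section \<open>Charts and tangent vectors\<close>

text \<open>Continuity alone makes a form vanish if it vanishes on a dense set, so multilinearity and
  alternation are not part of this definition.\<close>

definition continuous_forms ::
    "('a, 'e::real_inner) chart set \<Rightarrow> 'a set \<Rightarrow> nat \<Rightarrow> ('a, 'e) form set"
  where "continuous_forms A W r =
    {\<omega>. (\<forall>p vs. \<not> (p \<in> W \<and> length vs = r \<and> set vs \<subseteq> tangent_space A p) \<longrightarrow> \<omega> p vs = 0) \<and>
        (\<forall>c\<in>A. \<forall>us. length us = r \<longrightarrow>
           continuous_on (snd c ` (fst c \<inter> W)) (\<lambda>x. local_rep A c \<omega> x us))}"

lemma continuous_formsI:
  assumes "\<And>p vs. \<not> (p \<in> W \<and> length vs = r \<and> set vs \<subseteq> tangent_space A p) \<Longrightarrow> \<omega> p vs = 0"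
    and "\<And>c us. c \<in> A \<Longrightarrow> length us = r \<Longrightarrow>
      continuous_on (snd c ` (fst c \<inter> W)) (\<lambda>x. local_rep A c \<omega> x us)"
  shows "\<omega> \<in> continuous_forms A W r"
  using assms unfolding continuous_forms_def by blast

lemma continuous_forms_eq_0:
  assumes "\<omega> \<in> continuous_forms A W r" "\<not> (p \<in> W \<and> length vs = r \<and> set vs \<subseteq> tangent_space A p)"
  shows "\<omega> p vs = 0"
  using assms unfolding continuous_forms_def by blast

lemma continuous_on_local_rep:
  assumes "\<omega> \<in> continuous_forms A W r" "c \<in> A" "length us = r"
  shows "continuous_on (snd c ` (fst c \<inter> W)) (\<lambda>x. local_rep A c \<omega> x us)"
  using assms unfolding continuous_forms_def by blast

lemma formsD:
  assumes "\<omega> \<in> forms A W r"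
  shows "p \<in> W \<Longrightarrow> alternating_form (tangent_space A p) r (\<omega> p)"
    and "p \<notin> W \<Longrightarrow> \<omega> p = 0"
    and "c \<in> A \<Longrightarrow> length us = r \<Longrightarrow> smooth_on (snd c ` (fst c \<inter> W)) (\<lambda>x. local_rep A c \<omega> x us)"
  using assms unfolding forms_def by blast+

lemma forms_subset_continuous_forms: "forms A W r \<subseteq> continuous_forms A W r"
proof
  fix \<omega> assume \<omega>: "\<omega> \<in> forms A W r"
  show "\<omega> \<in> continuous_forms A W r"
  proof (rule continuous_formsI)
    fix p vs assume "\<not> (p \<in> W \<and> length vs = r \<and> set vs \<subseteq> tangent_space A p)"
    then show "\<omega> p vs = 0"
      using formsD(2)[OF \<omega>, of p] alternating_form_eq_0[OF formsD(1)[OF \<omega>], of p vs]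
      by (cases "p \<in> W") auto
  qed (rule smooth_on_imp_continuous_on[OF formsD(3)[OF \<omega>]])
qed

lemma scaleR_fun_apply: "(k *\<^sub>R g) x = k *\<^sub>R g x"
  by (simp add: scaleR_fun_def)

lemma local_rep_add: "local_rep A c (\<omega> + \<eta>) x us = local_rep A c \<omega> x us + local_rep A c \<eta> x us"
  by (simp add: local_rep_def)

lemma local_rep_scaleR: "local_rep A c (k *\<^sub>R \<omega>) x us = k * local_rep A c \<omega> x us"
  by (simp add: local_rep_def scaleR_fun_apply)

lemma subspace_continuous_forms: "subspace (continuous_forms A W r)"
  unfolding subspace_def
proof (intro conjI ballI allI)
  show "0 \<in> continuous_forms A W r"
    by (rule continuous_formsI) (auto simp: local_rep_def)
next
  fix \<omega> \<eta> assume \<omega>: "\<omega> \<in> continuous_forms A W r" and \<eta>: "\<eta> \<in> continuous_forms A W r"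
  show "\<omega> + \<eta> \<in> continuous_forms A W r"
    by (rule continuous_formsI)
      (simp_all add: local_rep_add continuous_forms_eq_0[OF \<omega>] continuous_forms_eq_0[OF \<eta>]
        continuous_on_add continuous_on_local_rep[OF \<omega>] continuous_on_local_rep[OF \<eta>])
next
  fix \<omega> and k :: real assume \<omega>: "\<omega> \<in> continuous_forms A W r"
  show "k *\<^sub>R \<omega> \<in> continuous_forms A W r"
    by (rule continuous_formsI)
      (simp_all add: local_rep_scaleR scaleR_fun_apply continuous_forms_eq_0[OF \<omega>]
        continuous_on_mult_left continuous_on_local_rep[OF \<omega>])
qed

lemma charts_atD: "c \<in> charts_at A p \<Longrightarrow> c \<in> A" "c \<in> charts_at A p \<Longrightarrow> p \<in> fst c"
  by (simp_all add: charts_at_def)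

context smooth_manifold
begin

lemma chart_subset: "c \<in> A \<Longrightarrow> fst c \<subseteq> topspace X"
  using chart_domain openin_subset by blast

lemma chart_inv_chart:
  assumes "c \<in> A" "p \<in> fst c"
  shows "chart_inv c (snd c p) = p"
proof -
  have "inj_on (snd c) (fst c)"
    using homeomorphic_imp_injective_map[OF chart_homeo[OF assms(1)]] chart_subset[OF assms(1)]
    by (simp add: Int_absorb1)
  then show ?thesis using assms(2) by simp
qed

lemma charts_at_exists: "p \<in> topspace X \<Longrightarrow> \<exists>c. c \<in> charts_at A p"
  using charts_cover unfolding charts_at_def by blast

lemma charts_at_topspace: "c \<in> charts_at A p \<Longrightarrow> p \<in> topspace X"
  using chart_subset[of c] by (auto simp: charts_at_def)

lemma open_chart_image:
  assumes "c \<in> A" "openin X U"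
  shows "open (snd c ` (fst c \<inter> U))"
proof -
  have "openin (subtopology X (fst c)) (fst c \<inter> U)"
    using assms(2) by (auto simp: openin_subtopology)
  then have "openin (top_of_set (snd c ` fst c)) (snd c ` (fst c \<inter> U))"
    using homeomorphic_imp_open_map[OF chart_homeo[OF assms(1)]] by (simp add: open_map_def)
  then show ?thesis using chart_image[OF assms(1)] openin_open_trans by blast
qed

lemma openin_chart_vimage:
  assumes "c \<in> A" "open V"
  shows "openin X {p \<in> fst c. snd c p \<in> V}"
proof -
  have "openin (top_of_set (snd c ` fst c)) (snd c ` fst c \<inter> V)"
    using assms(2) by (simp add: openin_open_Int)
  then have "openin (subtopology X (fst c))
      {p \<in> topspace (subtopology X (fst c)). snd c p \<in> snd c ` fst c \<inter> V}"
    by (rule openin_continuous_map_preimage[OF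
          homeomorphic_imp_continuous_map[OF chart_homeo[OF assms(1)]]])
  moreover have "{p \<in> topspace (subtopology X (fst c)). snd c p \<in> snd c ` fst c \<inter> V} =
      {p \<in> fst c. snd c p \<in> V}"
    using chart_subset[OF assms(1)] by auto
  ultimately show ?thesis using openin_trans_full chart_domain[OF assms(1)] by metis
qed

lemma coord_change_has_derivative:
  assumes "c \<in> charts_at A p" "c' \<in> charts_at A p"
  shows "((snd c' \<circ> chart_inv c) has_derivative coord_change c c' p) (at (snd c p))"
  unfolding coord_change_def
  by (rule smooth_on_has_derivative[OF charts_compatible]) (use assms in \<open>auto simp: charts_at_def\<close>)

text \<open>The chain rule for transition maps. The direct transition agrees with the composite on
  the image of the triple overlap, which is open, so the two have the same derivative at
  \<open>snd c p\<close>.\<close>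

lemma coord_change_trans:
  assumes "c \<in> charts_at A p" "c' \<in> charts_at A p" "c'' \<in> charts_at A p"
  shows "coord_change c' c'' p (coord_change c c' p u) = coord_change c c'' p u"
proof -
  note c = charts_atD[OF assms(1)] and c' = charts_atD[OF assms(2)] and c'' = charts_atD[OF assms(3)]
  have "(snd c' \<circ> chart_inv c) (snd c p) = snd c' p" using c by (simp add: chart_inv_chart)
  then have "((snd c'' \<circ> chart_inv c') \<circ> (snd c' \<circ> chart_inv c) has_derivative
      coord_change c' c'' p \<circ> coord_change c c' p) (at (snd c p))"
    using coord_change_has_derivative[OF assms(1,2)] coord_change_has_derivative[OF assms(2,3)]
    by (intro diff_chain_at) auto
  moreover have "open (snd c ` (fst c \<inter> (fst c' \<inter> fst c'')))"
    using c c' c'' chart_domain by (intro open_chart_image openin_Int) auto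
  ultimately have "((snd c'' \<circ> chart_inv c) has_derivative coord_change c' c'' p \<circ> coord_change c c' p)
      (at (snd c p))"
    by (rule has_derivative_transform_within_open)
      (use c c' c'' in \<open>auto simp: chart_inv_chart\<close>)
  then have "coord_change c c'' p = coord_change c' c'' p \<circ> coord_change c c' p"
    using coord_change_has_derivative[OF assms(1,3)] has_derivative_unique by blast
  then show ?thesis by simp
qed

lemma coord_vector_in_tangent_space:
  "c \<in> charts_at A p \<Longrightarrow> coord_vector A c p u \<in> tangent_space A p"
  by (simp add: tangent_space_def coord_vector_def coord_change_trans)

lemma coord_vector_of_tangent:
  assumes "c \<in> charts_at A p" "v \<in> tangent_space A p"
  shows "coord_vector A c p (v c) = v"
proof
  fix c'
  show "coord_vector A c p (v c) c' = v c'"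
    using assms unfolding tangent_space_def coord_vector_def mem_Collect_eq by metis
qed

lemma coord_vectors_of_tangents:
  assumes "c \<in> charts_at A p" "set vs \<subseteq> tangent_space A p"
  shows "map (coord_vector A c p) (map (\<lambda>v. v c) vs) = vs"
  using assms by (auto intro!: map_idI simp: coord_vector_of_tangent)

lemma coord_vector_change:
  assumes "c \<in> charts_at A p" "c' \<in> charts_at A p"
  shows "coord_vector A c' p (coord_change c c' p u) = coord_vector A c p u"
  using assms by (auto simp: coord_vector_def coord_change_trans)

lemma coord_vector_linear:
  assumes "c \<in> charts_at A p"
  shows "coord_vector A c p (a *\<^sub>R u + b *\<^sub>R w) = a *\<^sub>R coord_vector A c p u + b *\<^sub>R coord_vector A c p w"
proof -
  have "linear (coord_change c c' p)" if "c' \<in> charts_at A p" for c'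
    using coord_change_has_derivative[OF assms that] has_derivative_linear by blast
  then show ?thesis
    by (auto simp: coord_vector_def scaleR_fun_apply fun_eq_iff linear_add linear_cmul)
qed

lemma local_rep_chart:
  "c \<in> charts_at A p \<Longrightarrow> local_rep A c \<omega> (snd c p) us = \<omega> p (map (coord_vector A c p) us)"
  by (simp add: local_rep_def chart_inv_chart charts_atD)

lemma local_rep_coord_change:
  assumes "c \<in> charts_at A p" "c' \<in> charts_at A p"
  shows "local_rep A c \<omega> (snd c p) us = local_rep A c' \<omega> (snd c' p) (map (coord_change c c' p) us)"
  using assms by (simp add: local_rep_chart coord_vector_change cong: map_cong)

text \<open>Pulling back along the linear map \<open>coord_vector A c p\<close> moves the form to
  the model space, where all vectors are admissible arguments, as the lemmas stated for
  \<open>UNIV\<close> require.\<close>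

lemma alternating_form_local_rep:
  assumes \<omega>: "\<omega> \<in> forms A W r" and c: "c \<in> charts_at A p" and p: "p \<in> W"
  shows "alternating_form UNIV r (local_rep A c \<omega> (snd c p))"
proof -
  note alt = formsD(1)[OF \<omega> p]
  have T: "set (map (coord_vector A c p) us) \<subseteq> tangent_space A p" for us
    using coord_vector_in_tangent_space[OF c] by auto
  show ?thesis
    unfolding alternating_form_def
  proof (intro conjI allI impI; (elim conjE)?)
    fix us :: "'e list" assume "\<not> (length us = r \<and> set us \<subseteq> UNIV)"
    then show "local_rep A c \<omega> (snd c p) us = 0"
      unfolding local_rep_chart[OF c] by (intro alternating_form_eq_0[OF alt]) auto
  next
    fix us :: "'e list" and i v w a b assume "length us = r" "i < r"
    then show "local_rep A c \<omega> (snd c p) (us[i := a *\<^sub>R v + b *\<^sub>R w]) =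
        a * local_rep A c \<omega> (snd c p) (us[i := v]) + b * local_rep A c \<omega> (snd c p) (us[i := w])"
      unfolding local_rep_chart[OF c] map_update coord_vector_linear[OF c]
      by (intro alternating_form_update[OF alt _ T] coord_vector_in_tangent_space c) auto
  next
    fix us :: "'e list" and i j assume "length us = r" "i < j" "j < r" "us ! i = us ! j"
    then show "local_rep A c \<omega> (snd c p) us = 0"
      unfolding local_rep_chart[OF c] by (intro alternating_form_repeat[OF alt, of i j]) auto
  qed
qed

section \<open>The exterior derivative in coordinates\<close>

lemma local_rep_has_derivative:
  assumes "\<omega> \<in> forms A (topspace X) r" "c \<in> charts_at A p" "length us = r"
  shows "((\<lambda>x. local_rep A c \<omega> x us) has_derivative
    frechet_derivative (\<lambda>x. local_rep A c \<omega> x us) (at (snd c p))) (at (snd c p))"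
  using smooth_on_has_derivative[OF formsD(3)[OF assms(1) _ assms(3)]] assms(2)
    charts_atD[OF assms(2)] charts_at_topspace[OF assms(2)] by blast

text \<open>This is independence of the chart: the left side is evaluated in the chart selected at
  \<open>p\<close>, the right side in the given \<open>c\<close>. The two local representatives are
  pullbacks of each other along the transition map \<tau> from \<open>c\<close> to the selected
  chart, and the coordinate formula commutes with such a pullback.\<close>

lemma ext_d_coordinates:
  assumes \<omega>: "\<omega> \<in> forms A (topspace X) r" and c: "c \<in> charts_at A p" and us: "length us = Suc r"
  shows "ext_d A (topspace X) r \<omega> p (map (coord_vector A c p) us) =
    (\<Sum>i\<le>r. (-1) ^ i * frechet_derivative (\<lambda>x. local_rep A c \<omega> x (omit i us)) (at (snd c p)) (us ! i))"
proof -
  define c' where "c' = (SOME c. c \<in> charts_at A p)"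
  have c': "c' \<in> charts_at A p" unfolding c'_def using c by (rule someI)
  define \<tau> where "\<tau> = snd c' \<circ> chart_inv c"
  note cA = charts_atD[OF c] and c'A = charts_atD[OF c']
  have \<tau>p: "\<tau> (snd c p) = snd c' p" by (simp add: \<tau>_def chart_inv_chart cA)
  have T: "frechet_derivative \<tau> (at (snd c q)) = coord_change c c' q" for q
    by (simp add: \<tau>_def coord_change_def)
  let ?S = "snd c ` (fst c \<inter> fst c')"
  have "(\<Sum>i\<le>r. (-1) ^ i * frechet_derivative (\<lambda>x. local_rep A c \<omega> x (omit i us)) (at (snd c p)) (us ! i)) =
    (\<Sum>i\<le>r. (-1) ^ i *
      frechet_derivative (\<lambda>y. local_rep A c' \<omega> y (omit i (map (frechet_derivative \<tau> (at (snd c p))) us)))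
        (at (\<tau> (snd c p))) (map (frechet_derivative \<tau> (at (snd c p))) us ! i))"
  proof (rule coordinate_ext_d_pullback[OF finite_dim])
    show "open ?S" using cA c'A chart_domain by (intro open_chart_image) auto
    show "snd c p \<in> ?S" using cA c'A by auto
    show "cont_diff_on 2 ?S \<tau>"
      using charts_compatible[OF cA(1) c'A(1)] by (simp add: \<tau>_def smooth_on_def)
    show "length us = Suc r" by (rule us)
    show "(\<lambda>y. local_rep A c' \<omega> y ws) differentiable at (\<tau> (snd c p))" if "length ws = r" for ws
      unfolding \<tau>p using local_rep_has_derivative[OF \<omega> c' that] differentiableI by blast
    fix x assume "x \<in> ?S"
    then obtain q where q: "x = snd c q" "q \<in> fst c" "q \<in> fst c'" by auto
    then have cq: "c \<in> charts_at A q" "c' \<in> charts_at A q"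
      using cA c'A by (auto simp: charts_at_def)
    have \<tau>q: "\<tau> x = snd c' q" by (simp add: \<tau>_def chart_inv_chart cA q)
    show "local_rep A c \<omega> x ws = local_rep A c' \<omega> (\<tau> x) (map (frechet_derivative \<tau> (at x)) ws)" for ws
      unfolding \<tau>q unfolding q(1) T by (rule local_rep_coord_change[OF cq])
    show "alternating_form UNIV r (local_rep A c' \<omega> (\<tau> x))"
      unfolding \<tau>q by (rule alternating_form_local_rep[OF \<omega> cq(2) charts_at_topspace[OF cq(2)]])
  qed
  also have "\<dots> = ext_d A (topspace X) r \<omega> p (map (coord_vector A c p) us)"
  proof -
    have "coord_vector A c p u c' = coord_change c c' p u" for u
      using c' by (simp add: coord_vector_def)
    then show ?thesis
      using us charts_at_topspace[OF c] coord_vector_in_tangent_space[OF c]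
      by (auto simp: ext_d_def c'_def[symmetric] Let_def \<tau>p T o_def)
  qed
  finally show ?thesis by simp
qed

lemma continuous_on_chart_cong:
  assumes "c \<in> A" "\<And>p. c \<in> charts_at A p \<Longrightarrow> p \<in> W \<Longrightarrow> g (snd c p) = h (snd c p)"
    "continuous_on (snd c ` (fst c \<inter> W)) g"
  shows "continuous_on (snd c ` (fst c \<inter> W)) h"
  using assms(3) by (rule continuous_on_eq) (use assms(1,2) in \<open>auto simp: charts_at_def\<close>)

text \<open>On the domain of \<open>c\<close> every value can be computed in \<open>c\<close>
  itself, which gives a finite sum of derivatives of smooth functions of the coordinates.\<close>

lemma ext_d_continuous:
  assumes \<omega>: "\<omega> \<in> forms A (topspace X) r"
  shows "ext_d A (topspace X) r \<omega> \<in> continuous_forms A (topspace X) (Suc r)"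
proof (rule continuous_formsI)
  fix c and us :: "'e list" assume c: "c \<in> A" and us: "length us = Suc r"
  show "continuous_on (snd c ` (fst c \<inter> topspace X)) (\<lambda>x. local_rep A c (ext_d A (topspace X) r \<omega>) x us)"
  proof (rule continuous_on_chart_cong[OF c])
    show "continuous_on (snd c ` (fst c \<inter> topspace X)) (\<lambda>x. \<Sum>i\<le>r. (-1) ^ i *
        frechet_derivative (\<lambda>x. local_rep A c \<omega> x (omit i us)) (at x) (us ! i))"
      using us by (intro continuous_on_sum continuous_on_mult_left smooth_on_imp_continuous_on
          smooth_on_frechet_derivative formsD(3)[OF \<omega> c]) (simp add: length_omit del: length_append)
  qed (simp add: local_rep_chart ext_d_coordinates[OF \<omega> _ us])
qed (auto simp: ext_d_def)

text \<open>Unlike \<open>ext_d\<close>, the exterior product has no explicit guard on its domain.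
  The default comes from the factors: a nonzero summand has \<open>p\<close> in \<open>W\<close> and
  admissible arguments in both factors, and these arguments together exhaust
  \<open>vs\<close>.\<close>

lemma wedge1_eq_0:
  assumes \<theta>: "\<theta> \<in> continuous_forms A W 1" and \<omega>: "\<omega> \<in> continuous_forms A W r"
    and bad: "\<not> (p \<in> W \<and> length vs = Suc r \<and> set vs \<subseteq> tangent_space A p)"
  shows "wedge1 \<theta> \<omega> p vs = 0"
proof -
  have "\<theta> p [vs ! i] * \<omega> p (omit i vs) = 0" if i: "i < length vs" for i
  proof (rule ccontr)
    assume "\<not> ?thesis"
    then have "p \<in> W" "vs ! i \<in> tangent_space A p" "length (omit i vs) = r"
        "set (omit i vs) \<subseteq> tangent_space A p"
      using continuous_forms_eq_0[OF \<theta>, of p "[vs ! i]"] continuous_forms_eq_0[OF \<omega>, of p "omit i vs"]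
      by auto
    moreover have "set vs \<subseteq> insert (vs ! i) (set (omit i vs))"
      using id_take_nth_drop[OF i] by (metis list.set(2) set_append Un_insert_right set_eq_subset)
    moreover have "length vs = Suc (length (omit i vs))" using i by simp
    ultimately show False using bad by blast
  qed
  then show ?thesis unfolding wedge1_def by (intro sum.neutral) auto
qed

lemma wedge1_continuous:
  assumes \<theta>: "\<theta> \<in> continuous_forms A W 1" and \<omega>: "\<omega> \<in> continuous_forms A W r"
  shows "wedge1 \<theta> \<omega> \<in> continuous_forms A W (Suc r)"
proof (rule continuous_formsI)
  fix c and us :: "'e list" assume c: "c \<in> A" and us: "length us = Suc r"
  have "local_rep A c (wedge1 \<theta> \<omega>) x us =
      (\<Sum>i<Suc r. (-1) ^ i * local_rep A c \<theta> x [us ! i] * local_rep A c \<omega> x (omit i us))" for x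
    using us by (simp add: local_rep_def wedge1_def map_omit del: map_append sum.lessThan_Suc)
  then show "continuous_on (snd c ` (fst c \<inter> W)) (\<lambda>x. local_rep A c (wedge1 \<theta> \<omega>) x us)"
    using us by (auto intro!: continuous_on_sum continuous_on_mult continuous_on_const
        continuous_on_local_rep[OF \<theta> c] continuous_on_local_rep[OF \<omega> c]
        simp: length_omit simp del: length_append sum.lessThan_Suc)
qed (rule wedge1_eq_0[OF \<theta> \<omega>])

lemma chart_Int_topspace: "c \<in> A \<Longrightarrow> fst c \<inter> topspace X = fst c"
  using chart_subset by blast

lemma fun_mult_continuous:
  assumes f: "smooth_fun A f" and \<omega>: "\<omega> \<in> continuous_forms A (topspace X) r"
  shows "fun_mult f \<omega> \<in> continuous_forms A (topspace X) r"
proof (rule continuous_formsI)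
  fix c and us :: "'e list" assume c: "c \<in> A" and us: "length us = r"
  have "continuous_on (snd c ` fst c) (f \<circ> chart_inv c)"
    using f c smooth_on_imp_continuous_on unfolding smooth_fun_def by blast
  then have "continuous_on (snd c ` fst c) (\<lambda>x. (f \<circ> chart_inv c) x * local_rep A c \<omega> x us)"
    using continuous_on_local_rep[OF \<omega> c us] by (intro continuous_on_mult) (simp_all add: chart_Int_topspace c)
  then show "continuous_on (snd c ` (fst c \<inter> topspace X)) (\<lambda>x. local_rep A c (fun_mult f \<omega>) x us)"
    using c by (simp add: chart_Int_topspace local_rep_def fun_mult_def scaleR_fun_apply)
qed (simp add: fun_mult_def scaleR_fun_apply continuous_forms_eq_0[OF \<omega>])

lemma local_rep_fun_form:
  "c \<in> A \<Longrightarrow> x \<in> snd c ` fst c \<Longrightarrow> local_rep A c (fun_form (topspace X) f) x [] = (f \<circ> chart_inv c) x"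
  using chart_subset[of c] by (auto simp: local_rep_def fun_form_def chart_inv_chart)

lemma fun_form_in_forms:
  assumes "smooth_fun A f"
  shows "fun_form (topspace X) f \<in> forms A (topspace X) 0"
proof -
  have "smooth_on (snd c ` fst c) (\<lambda>x. local_rep A c (fun_form (topspace X) f) x [])" if "c \<in> A" for c
    by (rule smooth_on_cong[OF chart_image[OF that] local_rep_fun_form[OF that, symmetric]])
      (use assms that in \<open>simp_all add: smooth_fun_def o_def\<close>)
  then show ?thesis
    by (auto simp: forms_def fun_form_def alternating_form_def fun_eq_iff chart_Int_topspace)
qed

lemma d_f_theta_continuous:
  assumes f: "smooth_fun A f" and \<theta>: "\<theta> \<in> forms A (topspace X) 1" and \<omega>: "\<omega> \<in> forms A (topspace X) r"
  shows "d_f_theta X A f \<theta> r \<omega> \<in> continuous_forms A (topspace X) (Suc r)"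
proof -
  have "\<omega> \<in> continuous_forms A (topspace X) r" "\<theta> \<in> continuous_forms A (topspace X) 1"
    using \<omega> \<theta> forms_subset_continuous_forms by blast+
  moreover have "ext_d A (topspace X) 0 (fun_form (topspace X) f) \<in> continuous_forms A (topspace X) 1"
    using ext_d_continuous[OF fun_form_in_forms[OF f]] by simp
  ultimately show ?thesis
    unfolding d_f_theta_def d_f_def
    by (intro subspace_diff subspace_scale subspace_continuous_forms wedge1_continuous
        fun_mult_continuous f ext_d_continuous[OF \<omega>])
qed

text \<open>Tangent vectors at different points are compared through their coordinates: with
  \<open>us\<close> frozen, a value nonzero at \<open>p\<close> stays nonzero on a neighbourhood of
  \<open>p\<close> in the chart. That neighbourhood would be a nonempty open subset of the zero
  set.\<close>

lemma continuous_form_eq_0: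
  assumes f: "smooth_fun A f" and dense: "X interior_of (zero_set X f) = {}"
    and \<omega>: "\<omega> \<in> continuous_forms A (topspace X) r"
    and zero: "\<And>p. p \<in> topspace X - zero_set X f \<Longrightarrow> \<omega> p = 0"
  shows "\<omega> = 0"
proof -
  have "\<omega> p vs = 0" for p vs
  proof (cases "p \<in> topspace X \<and> length vs = r \<and> set vs \<subseteq> tangent_space A p")
    case True
    then obtain c where c: "c \<in> charts_at A p" using charts_at_exists by blast
    note cA = charts_atD[OF c]
    define us where "us = map (\<lambda>v. v c) vs"
    have vs: "\<omega> p vs = local_rep A c \<omega> (snd c p) us"
      using True c by (simp add: local_rep_chart us_def coord_vectors_of_tangents del: map_map)
    have us: "length us = r" using True by (simp add: us_def)
    show ?thesis
    proof (rule ccontr)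
      assume nz: "\<omega> p vs \<noteq> 0"
      define V where "V = snd c ` fst c \<inter> (\<lambda>x. local_rep A c \<omega> x us) -` (- {0})"
      have "open V"
        using continuous_on_local_rep[OF \<omega> cA(1) us] chart_image[OF cA(1)] unfolding V_def
        by (intro continuous_open_preimage) (auto simp: chart_Int_topspace cA)
      then have "openin X {q \<in> fst c. snd c q \<in> V}"
        using cA(1) by (rule openin_chart_vimage[rotated])
      moreover have "q \<in> zero_set X f" if q: "q \<in> fst c" "snd c q \<in> V" for q
      proof (rule ccontr)
        assume "q \<notin> zero_set X f"
        then have "\<omega> q = 0" using zero q(1) chart_subset[OF cA(1)] by blast
        then show False using q cA(1) by (simp add: V_def local_rep_def chart_inv_chart)
      qed
      ultimately have "{q \<in> fst c. snd c q \<in> V} \<subseteq> X interior_of (zero_set X f)"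
        by (intro interior_of_maximal) auto
      moreover have "p \<in> {q \<in> fst c. snd c q \<in> V}" using cA nz vs by (simp add: V_def)
      ultimately show False using dense by blast
    qed
  qed (rule continuous_forms_eq_0[OF \<omega>])
  then show ?thesis by (simp add: fun_eq_iff)
qed

end

section \<open>Comparison of the two complexes\<close>

text \<open>Since the subspace \<open>D\<close> on which \<open>\<Phi>\<close> is injective contains \<open>Z'\<close> and \<open>B'\<close>, a set \<open>\<Phi> ` P\<close> with
  \<open>P \<subseteq> D\<close> determines \<open>P\<close>; in particular no quotient has to be checked for well-definedness.\<close>

lemma isomorphic_quotients_linear_image:
  fixes \<Phi> :: "'w::real_vector \<Rightarrow> 'v::real_vector"
  assumes lin: "linear \<Phi>" and D: "subspace D" and inj: "inj_on \<Phi> D"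
    and Z': "Z' \<subseteq> D" and B': "B' \<subseteq> D"
  shows "isomorphic_quotients (\<Phi> ` Z') (\<Phi> ` B') Z' B'"
proof -
  \<comment> \<open>The isomorphism runs from classes of images back to classes in
    \<open>Z'\<close>: it is the preimage under \<open>\<Phi>\<close> cut down to \<open>D\<close>,
    and inverts the formation of images on subsets of \<open>D\<close>.\<close>
  define h where "h P = {x \<in> D. \<Phi> x \<in> P}" for P
  have h_image: "h (\<Phi> ` P) = P" if "P \<subseteq> D" for P
    using that inj unfolding h_def inj_on_def by blast
  let ?R' = "{(x, y) \<in> Z' \<times> Z'. x - y \<in> B'}"
  let ?R = "{(x, y) \<in> \<Phi> ` Z' \<times> \<Phi> ` Z'. x - y \<in> \<Phi> ` B'}"
  have diff: "\<Phi> x - \<Phi> y \<in> \<Phi> ` B' \<longleftrightarrow> x - y \<in> B'" if "x \<in> Z'" "y \<in> Z'" for x y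
  proof -
    have "x - y \<in> D" using that Z' D by (blast intro: subspace_diff)
    then show ?thesis
      using inj_on_image_mem_iff[OF inj _ B'] by (simp add: linear_diff[OF lin, symmetric])
  qed
  have "?R `` {\<Phi> x} = \<Phi> ` (?R' `` {x})" if "x \<in> Z'" for x
    using that diff[OF that] by auto
  then have Q: "quotient_space (\<Phi> ` Z') (\<Phi> ` B') = image \<Phi> ` quotient_space Z' B'"
    by (auto simp: quotient_space_def quotient_def image_UN)
  have sub: "P \<subseteq> D" if "P \<in> quotient_space Z' B'" for P
    using that Z' by (auto simp: quotient_space_def quotient_def)
  show ?thesis
    unfolding isomorphic_quotients_def Q
  proof (intro exI[of _ h] conjI ballI allI)
    show "bij_betw h (image \<Phi> ` quotient_space Z' B') (quotient_space Z' B')"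
      by (rule bij_betw_byWitness[where f' = "image \<Phi>"]) (auto simp: h_image sub)
  next
    fix P Q assume "P \<in> image \<Phi> ` quotient_space Z' B'" "Q \<in> image \<Phi> ` quotient_space Z' B'"
    then obtain P' Q' where P': "P = \<Phi> ` P'" "P' \<subseteq> D" and Q': "Q = \<Phi> ` Q'" "Q' \<subseteq> D"
      using sub by blast
    have "coset_add P Q = \<Phi> ` coset_add P' Q'"
    proof
      show "coset_add P Q \<subseteq> \<Phi> ` coset_add P' Q'"
        by (auto simp: P' Q' coset_add_def linear_add[OF lin, symmetric] intro!: imageI) blast
      show "\<Phi> ` coset_add P' Q' \<subseteq> coset_add P Q"
        by (auto simp: P' Q' coset_add_def linear_add[OF lin]) blast
    qed
    \<comment> \<open>Closure of the subspace \<open>D\<close> under sums keeps the result within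
      reach of \<open>h_image\<close>.\<close>
    moreover have "coset_add P' Q' \<subseteq> D"
      unfolding coset_add_def using P' Q' D subspace_add by blast
    ultimately show "h (coset_add P Q) = coset_add (h P) (h Q)"
      by (simp add: h_image P' Q')
  next
    fix c P assume "P \<in> image \<Phi> ` quotient_space Z' B'"
    then obtain P' where P': "P = \<Phi> ` P'" "P' \<subseteq> D" using sub by blast
    have "coset_scale (\<Phi> ` B') c P = \<Phi> ` coset_scale B' c P'"
    proof
      have comb: "\<Phi> (c *\<^sub>R x + b) = c *\<^sub>R \<Phi> x + \<Phi> b" for x b
        by (simp add: linear_add[OF lin] linear_cmul[OF lin])
      show "coset_scale (\<Phi> ` B') c P \<subseteq> \<Phi> ` coset_scale B' c P'"
        by (auto simp: P' coset_scale_def comb[symmetric] intro!: imageI) blast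
      show "\<Phi> ` coset_scale B' c P' \<subseteq> coset_scale (\<Phi> ` B') c P"
        by (auto simp: P' coset_scale_def comb) blast
    qed
    moreover have "coset_scale B' c P' \<subseteq> D"
      unfolding coset_scale_def using P' B' D by (blast intro: subspace_add subspace_scale)
    ultimately show "h (coset_scale (\<Phi> ` B') c P) = coset_scale B' c (h P)"
      by (simp add: h_image P')
  qed
qed

section \<open>Division by powers of the function off its zero set\<close>

definition divide_form :: "'a set \<Rightarrow> ('a \<Rightarrow> real) \<Rightarrow> nat \<Rightarrow> ('a, 'e::real_inner) form \<Rightarrow> ('a, 'e) form"
  where "divide_form W f r \<omega> = (\<lambda>p. if p \<in> W then inverse (f p) ^ r *\<^sub>R \<omega> p else 0)"

lemma divide_form_apply:
  "divide_form W f r \<omega> p vs = (if p \<in> W then inverse (f p) ^ r * \<omega> p vs else 0)"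
  by (simp add: divide_form_def scaleR_fun_apply)

lemma linear_divide_form: "linear (divide_form W f r)"
  by (rule linearI) (simp_all add: fun_eq_iff divide_form_apply scaleR_fun_apply distrib_left)

lemma alternating_form_scaleR:
  "alternating_form T r \<alpha> \<Longrightarrow> alternating_form T r (k *\<^sub>R \<alpha>)"
  unfolding alternating_form_def by (simp add: scaleR_fun_apply algebra_simps)

lemma local_rep_divide_form:
  "chart_inv c x \<in> W \<Longrightarrow>
    local_rep A c (divide_form W f r \<omega>) x us = inverse ((f \<circ> chart_inv c) x) ^ r * local_rep A c \<omega> x us"
  by (simp add: local_rep_def divide_form_apply)

text \<open>The origin of the coefficient r in \<open>d_f\<close>, and of the exponent that follows
  the degree: differentiating the r-th inverse power gives the factor -r and one more
  inverse.\<close>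

lemma has_derivative_inverse_power:
  fixes F :: "'e::real_normed_vector \<Rightarrow> real"
  assumes F: "(F has_derivative F') (at x)" and nz: "F x \<noteq> 0"
  shows "((\<lambda>x. inverse (F x) ^ r) has_derivative (\<lambda>v. - real r * inverse (F x) ^ Suc r * F' v)) (at x)"
proof -
  have "DERIV (\<lambda>t. inverse t ^ r) (F x) :> - real r * inverse (F x) ^ Suc r"
    \<comment> \<open>The power rule produces the exponent r - 1 in the natural numbers; the case r
      = 0 is separate, with coefficient 0.\<close>
    using nz by (auto intro!: derivative_eq_intros) (cases r; simp add: power2_eq_square)
  then show ?thesis
    unfolding has_field_derivative_def by (rule has_derivative_compose[OF F])
qed

context smooth_manifold
begin

context
  fixes f :: "'a \<Rightarrow> real" and W
  assumes f: "smooth_fun A f" and W_def: "W = topspace X - zero_set X f"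
begin

lemma regular_setD: "p \<in> W \<Longrightarrow> p \<in> topspace X" "p \<in> W \<Longrightarrow> f p \<noteq> 0"
  by (auto simp: W_def zero_set_def)

lemma smooth_on_chart: "c \<in> A \<Longrightarrow> smooth_on (snd c ` fst c) (f \<circ> chart_inv c)"
  using f by (simp add: smooth_fun_def)

lemma open_regular_chart_image:
  assumes c: "c \<in> A"
  shows "open (snd c ` (fst c \<inter> W))"
proof -
  have "snd c ` (fst c \<inter> W) = snd c ` fst c \<inter> (f \<circ> chart_inv c) -` (- {0})"
    using chart_subset[OF c] by (auto simp: W_def zero_set_def chart_inv_chart c)
  moreover have "open (snd c ` fst c \<inter> (f \<circ> chart_inv c) -` (- {0}))"
    using smooth_on_imp_continuous_on[OF smooth_on_chart[OF c]] chart_image[OF c]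
    by (intro continuous_open_preimage) auto
  ultimately show ?thesis by simp
qed

lemma divide_form_in_forms:
  assumes \<omega>: "\<omega> \<in> forms A (topspace X) r"
  shows "divide_form W f r \<omega> \<in> forms A W r"
  unfolding forms_def
proof (intro CollectI conjI ballI allI impI)
  show "alternating_form (tangent_space A p) r (divide_form W f r \<omega> p)" if "p \<in> W" for p
    using that regular_setD alternating_form_scaleR[OF formsD(1)[OF \<omega>]] by (simp add: divide_form_def)
  show "divide_form W f r \<omega> p = 0" if "p \<notin> W" for p
    using that by (simp add: divide_form_def)
  fix c and us :: "'e list" assume c: "c \<in> A" and us: "length us = r"
  let ?S = "snd c ` (fst c \<inter> W)"
  have sub: "?S \<subseteq> snd c ` fst c" by blast
  have inv: "chart_inv c x \<in> W" if "x \<in> ?S" for x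
    using that by (auto simp: chart_inv_chart c)
  have F: "cont_diff_on n ?S (f \<circ> chart_inv c)" for n
    using smooth_on_chart[OF c] cont_diff_on_subset[OF _ sub] by (auto simp: smooth_on_def)
  have L: "cont_diff_on n ?S (\<lambda>x. local_rep A c \<omega> x us)" for n
    using formsD(3)[OF \<omega> c us] cont_diff_on_subset[OF _ sub]
    by (auto simp: smooth_on_def chart_Int_topspace c)
  have "cont_diff_on n ?S (\<lambda>x. inverse ((f \<circ> chart_inv c) x) ^ r * local_rep A c \<omega> x us)" for n
    using regular_setD(2)[OF inv]
    by (intro cont_diff_on_mult cont_diff_on_power cont_diff_on_inverse open_regular_chart_image c F L) auto
  then show "smooth_on ?S (\<lambda>x. local_rep A c (divide_form W f r \<omega>) x us)"
    by (intro smooth_on_cong[OF open_regular_chart_image[OF c] local_rep_divide_form[symmetric]])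
      (auto simp: smooth_on_def inv)
qed

text \<open>Any smooth extension of the product with the r-th power serves as preimage; its
  uniqueness is the content of \<open>inj_on_divide_form\<close>. Off \<open>W\<close> both sides
  agree because forms on \<open>W\<close> have the default value 0 there.\<close>

lemma singular_forms_eq: "singular_forms X A f r = divide_form W f r ` forms A (topspace X) r"
proof (intro equalityI subsetI)
  fix \<phi> assume "\<phi> \<in> singular_forms X A f r"
  then obtain \<psi> where \<phi>: "\<phi> \<in> forms A W r" and \<psi>: "\<psi> \<in> forms A (topspace X) r"
    and ext: "\<And>p. p \<in> W \<Longrightarrow> \<psi> p = fun_mult (\<lambda>q. f q ^ r) \<phi> p"
    by (auto simp: singular_forms_def W_def)
  have "\<phi> p vs = divide_form W f r \<psi> p vs" for p vs
    using formsD(2)[OF \<phi>, of p] ext[of p] regular_setD(2)[of p]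
    by (simp add: divide_form_apply fun_mult_def scaleR_fun_apply power_inverse)
  then have "\<phi> = divide_form W f r \<psi>" by (simp add: fun_eq_iff)
  then show "\<phi> \<in> divide_form W f r ` forms A (topspace X) r" using \<psi> by blast
next
  fix \<phi> assume "\<phi> \<in> divide_form W f r ` forms A (topspace X) r"
  then obtain \<psi> where \<psi>: "\<psi> \<in> forms A (topspace X) r" and \<phi>: "\<phi> = divide_form W f r \<psi>" by blast
  have "\<psi> p = fun_mult (\<lambda>q. f q ^ r) \<phi> p" if "p \<in> W" for p
    using that regular_setD(2)[OF that]
    by (auto simp: fun_eq_iff \<phi> divide_form_apply fun_mult_def scaleR_fun_apply power_inverse)
  then show "\<phi> \<in> singular_forms X A f r"
    using \<psi> divide_form_in_forms[OF \<psi>] by (auto simp: singular_forms_def W_def[symmetric] \<phi>)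
qed

text \<open>Division forgets only the values on the zero set, and these are determined by
  continuity. The domain consists of continuous forms so that the values of \<open>d_f_theta\<close>
  are covered too.\<close>

lemma inj_on_divide_form:
  assumes "X interior_of (zero_set X f) = {}"
  shows "inj_on (divide_form W f r) (continuous_forms A (topspace X) k)"
proof (rule inj_onI)
  fix \<omega> \<eta> assume \<omega>: "\<omega> \<in> continuous_forms A (topspace X) k" and \<eta>: "\<eta> \<in> continuous_forms A (topspace X) k"
    and eq: "divide_form W f r \<omega> = divide_form W f r \<eta>"
  have "(\<omega> - \<eta>) p = 0" if "p \<in> topspace X - zero_set X f" for p
  proof -
    have "inverse (f p) ^ r * \<omega> p vs = inverse (f p) ^ r * \<eta> p vs" for vs
      using fun_cong[OF fun_cong[OF eq], of p vs] that by (simp add: divide_form_apply W_def)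
    then show ?thesis using that regular_setD(2)[of p] by (simp add: fun_eq_iff W_def)
  qed
  then have "\<omega> - \<eta> = 0"
    by (intro continuous_form_eq_0[OF f assms subspace_diff[OF subspace_continuous_forms \<omega> \<eta>]])
  then show "\<omega> = \<eta>" by simp
qed

text \<open>A pointwise identity: at a given \<open>p\<close> the exterior derivatives of the
  quotient, of \<omega> and of \<open>f\<close> are all evaluated in the same selected chart, so
  everything reduces to the product rule in that chart.\<close>

lemma d_theta_divide_form:
  assumes \<theta>: "\<theta> \<in> forms A (topspace X) 1" and \<omega>: "\<omega> \<in> forms A (topspace X) r"
  shows "d_theta A W \<theta> r (divide_form W f r \<omega>) = divide_form W f (Suc r) (d_f_theta X A f \<theta> r \<omega>)"
proof (intro ext)
  fix p vs
  define df where "df = ext_d A (topspace X) 0 (fun_form (topspace X) f)"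
  define k where "k = inverse (f p)"
  have d_f_theta: "d_f_theta X A f \<theta> r \<omega> p vs = f p * ext_d A (topspace X) r \<omega> p vs -
      real r * wedge1 df \<omega> p vs - f p * wedge1 \<theta> \<omega> p vs"
    by (simp add: d_f_theta_def d_f_def df_def fun_mult_def scaleR_fun_apply wedge1_def
        sum_distrib_left mult.commute mult.left_commute)
  show "d_theta A W \<theta> r (divide_form W f r \<omega>) p vs = divide_form W f (Suc r) (d_f_theta X A f \<theta> r \<omega>) p vs"
  proof (cases "p \<in> W")
    case False
    then show ?thesis by (simp add: d_theta_def ext_d_def wedge1_def divide_form_apply)
  next
    case True
    then have p: "p \<in> topspace X" "f p \<noteq> 0" using regular_setD by auto
    then have kf: "k * f p = 1" by (simp add: k_def)
    have wedge: "wedge1 \<theta> (divide_form W f r \<omega>) p vs = k ^ r * wedge1 \<theta> \<omega> p vs"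
      using True by (simp add: wedge1_def divide_form_apply k_def sum_distrib_left mult.left_commute)
    have ext: "ext_d A W r (divide_form W f r \<omega>) p vs =
        k ^ r * ext_d A (topspace X) r \<omega> p vs - real r * k ^ Suc r * wedge1 df \<omega> p vs"
    proof (cases "length vs = Suc r \<and> set vs \<subseteq> tangent_space A p")
      \<comment> \<open>On inadmissible arguments the exterior derivatives vanish by their guard and
        the exterior product by the defaults of its factors.\<close>
      case False
      have "\<omega> \<in> continuous_forms A (topspace X) r" "df \<in> continuous_forms A (topspace X) 1"
        using \<omega> forms_subset_continuous_forms ext_d_continuous[OF fun_form_in_forms[OF f]]
        by (auto simp: df_def)
      then have "wedge1 df \<omega> p vs = 0" using False wedge1_eq_0 by blast
      then show ?thesis using False by (auto simp: ext_d_def)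
    next
      case good: True
      define c where "c = (SOME c. c \<in> charts_at A p)"
      have c: "c \<in> charts_at A p" unfolding c_def using charts_at_exists[OF p(1)] by (rule someI_ex)
      note cA = charts_atD[OF c]
      define us where "us = map (\<lambda>v. v c) vs"
      have us: "length us = Suc r" using good by (simp add: us_def)
      have vs: "map (coord_vector A c p) us = vs"
        using good c by (simp add: us_def coord_vectors_of_tangents del: map_map)
      define DF where "DF = frechet_derivative (f \<circ> chart_inv c) (at (snd c p))"
      define DL where "DL ws = frechet_derivative (\<lambda>x. local_rep A c \<omega> x ws) (at (snd c p))" for ws
      have Fp: "(f \<circ> chart_inv c) (snd c p) = f p" by (simp add: chart_inv_chart cA)
      have dF: "((f \<circ> chart_inv c) has_derivative DF) (at (snd c p))"
        unfolding DF_def using smooth_on_has_derivative[OF smooth_on_chart] cA by blast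
      have step: "frechet_derivative (\<lambda>x. local_rep A c (divide_form W f r \<omega>) x ws) (at (snd c p)) v =
          k ^ r * DL ws v - real r * k ^ Suc r * (DF v * local_rep A c \<omega> (snd c p) ws)"
        if "length ws = r" for ws v
      proof -
        have "((\<lambda>x. inverse ((f \<circ> chart_inv c) x) ^ r * local_rep A c \<omega> x ws) has_derivative
          (\<lambda>v. inverse ((f \<circ> chart_inv c) (snd c p)) ^ r * DL ws v +
            (- real r * inverse ((f \<circ> chart_inv c) (snd c p)) ^ Suc r * DF v) *
            local_rep A c \<omega> (snd c p) ws)) (at (snd c p))"
          using p Fp unfolding DL_def
          by (intro has_derivative_mult has_derivative_inverse_power dF local_rep_has_derivative[OF \<omega> c that]) simp
        then have "((\<lambda>x. local_rep A c (divide_form W f r \<omega>) x ws) has_derivative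
          (\<lambda>v. inverse ((f \<circ> chart_inv c) (snd c p)) ^ r * DL ws v +
            (- real r * inverse ((f \<circ> chart_inv c) (snd c p)) ^ Suc r * DF v) *
            local_rep A c \<omega> (snd c p) ws)) (at (snd c p))"
          by (rule has_derivative_transform_within_open[OF _ open_regular_chart_image[OF cA(1)]])
            (use cA True in \<open>auto simp: local_rep_divide_form chart_inv_chart\<close>)
        then show ?thesis
          unfolding Fp k_def[symmetric] by (simp add: fun_cong[OF frechet_derivative_at, symmetric])
      qed
      \<comment> \<open>For a 0-form the sum in \<open>ext_d\<close> has the single index 0 and the
        list of remaining arguments is empty, so df is the derivative of \<open>f\<close> in
        coordinates.\<close>
      have df: "df p [v] = DF (v c)" if "v \<in> tangent_space A p" for v
      proof -
        have "frechet_derivative (\<lambda>x. local_rep A c (fun_form (topspace X) f) x []) (at (snd c p)) = DF"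
          unfolding DF_def using cA
          by (intro frechet_derivative_cong[OF chart_image[OF cA(1)]] local_rep_fun_form) auto
        then show ?thesis
          using p(1) that by (simp add: df_def ext_d_def c_def[symmetric] Let_def)
      qed
      have "ext_d A W r (divide_form W f r \<omega>) p vs = (\<Sum>i\<le>r. (-1) ^ i *
          (k ^ r * DL (omit i us) (us ! i) -
            real r * k ^ Suc r * (DF (us ! i) * local_rep A c \<omega> (snd c p) (omit i us))))"
      proof -
        have "ext_d A W r (divide_form W f r \<omega>) p vs = (\<Sum>i\<le>r. (-1) ^ i *
            frechet_derivative (\<lambda>x. local_rep A c (divide_form W f r \<omega>) x (omit i us)) (at (snd c p)) (us ! i))"
          unfolding ext_d_def Let_def c_def[symmetric] us_def[symmetric] using True good by simp
        then show ?thesis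
          using us by (simp add: step length_omit del: length_append)
      qed
      also have "\<dots> = k ^ r * (\<Sum>i\<le>r. (-1) ^ i * DL (omit i us) (us ! i)) -
          real r * k ^ Suc r * (\<Sum>i\<le>r. (-1) ^ i * DF (us ! i) * local_rep A c \<omega> (snd c p) (omit i us))"
        by (simp add: sum_distrib_left sum_subtractf right_diff_distrib mult.left_commute mult.assoc)
      also have "(\<Sum>i\<le>r. (-1) ^ i * DL (omit i us) (us ! i)) = ext_d A (topspace X) r \<omega> p vs"
        unfolding ext_d_def Let_def c_def[symmetric] us_def[symmetric] DL_def using p(1) good by simp
      also have "(\<Sum>i\<le>r. (-1) ^ i * DF (us ! i) * local_rep A c \<omega> (snd c p) (omit i us)) =
          wedge1 df \<omega> p vs"
      proof -
        have "DF (us ! i) = df p [vs ! i]" if "i \<le> r" for i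
          using that good df[of "vs ! i"] nth_mem[of i vs] by (simp add: us_def subset_iff)
        moreover have "local_rep A c \<omega> (snd c p) (omit i us) = \<omega> p (omit i vs)" for i
          unfolding local_rep_chart[OF c] map_omit vs ..
        ultimately show ?thesis
          using good unfolding wedge1_def by (intro sum.cong) auto
      qed
      finally show ?thesis .
    qed
    \<comment> \<open>The factors f in front of d\<omega> and of \<theta> in
      \<open>d_f_theta\<close> each cancel one of the r + 1 inverse factors; the df term carries no
      f and keeps all of them.\<close>
    have k: "k ^ Suc r * (f p * x) = k ^ r * x" for x
    proof -
      have "k ^ Suc r * (f p * x) = k ^ r * (k * f p) * x" by (simp add: mult.assoc mult.left_commute)
      then show ?thesis by (simp add: kf)
    qed
    have "divide_form W f (Suc r) (d_f_theta X A f \<theta> r \<omega>) p vs =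
        k ^ Suc r * d_f_theta X A f \<theta> r \<omega> p vs"
      using True by (simp add: divide_form_apply k_def)
    then show ?thesis
      unfolding d_f_theta
      by (simp add: k d_theta_def ext wedge right_diff_distrib mult.left_commute[of "real r"] del: power_Suc)
  qed
qed

lemma isomorphic_cohomology_singular_forms:
  assumes dense: "X interior_of (zero_set X f) = {}" and \<theta>: "\<theta> \<in> forms A (topspace X) 1"
  shows "isomorphic_cohomology (singular_forms X A f) (d_theta A W \<theta>)
    (forms A (topspace X)) (d_f_theta X A f \<theta>)"
  unfolding isomorphic_cohomology_def
proof
  fix r
  let ?\<Omega> = "forms A (topspace X)" and ?d = "d_f_theta X A f \<theta>" and ?\<Phi> = "divide_form W f"
  note intertwine = d_theta_divide_form[OF \<theta>]
  \<comment> \<open>From left to right this uses injectivity in degree and exponent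
    \<open>Suc r\<close>, for the continuous forms \<open>?d r \<omega>\<close> and 0.\<close>
  have "d_theta A W \<theta> r (?\<Phi> r \<omega>) = 0 \<longleftrightarrow> ?d r \<omega> = 0" if \<omega>: "\<omega> \<in> ?\<Omega> r" for \<omega>
  proof -
    have "?d r \<omega> \<in> continuous_forms A (topspace X) (Suc r)"
      by (rule d_f_theta_continuous[OF f \<theta> \<omega>])
    moreover have "0 \<in> continuous_forms A (topspace X) (Suc r)"
      by (rule subspace_0[OF subspace_continuous_forms])
    ultimately show ?thesis
      using inj_on_eq_iff[OF inj_on_divide_form[OF dense]] linear_0[OF linear_divide_form]
      by (metis intertwine[OF \<omega>])
  qed
  then have Z: "cocycles (singular_forms X A f) (d_theta A W \<theta>) r = ?\<Phi> r ` cocycles ?\<Omega> ?d r"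
    by (auto simp: cocycles_def singular_forms_eq)
  have B: "coboundaries (singular_forms X A f) (d_theta A W \<theta>) r = ?\<Phi> r ` coboundaries ?\<Omega> ?d r"
  proof (cases r)
    case 0
    then show ?thesis by (simp add: coboundaries_def linear_0[OF linear_divide_form])
  next
    case (Suc k)
    then show ?thesis
      by (simp add: coboundaries_def singular_forms_eq image_image intertwine cong: image_cong)
  qed
  \<comment> \<open>The continuous forms serve as the ambient subspace because
    \<open>d_f_theta_continuous\<close> places the coboundaries there.\<close>
  have "coboundaries ?\<Omega> ?d r \<subseteq> continuous_forms A (topspace X) r"
    using d_f_theta_continuous[OF f \<theta>] subspace_0[OF subspace_continuous_forms]
    by (auto simp: coboundaries_def split: nat.split)
  moreover have "cocycles ?\<Omega> ?d r \<subseteq> continuous_forms A (topspace X) r"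
    using forms_subset_continuous_forms by (auto simp: cocycles_def)
  ultimately show "isomorphic_quotients
      (cocycles (singular_forms X A f) (d_theta A W \<theta>) r)
      (coboundaries (singular_forms X A f) (d_theta A W \<theta>) r)
      (cocycles ?\<Omega> ?d r) (coboundaries ?\<Omega> ?d r)"
    unfolding Z B
    by (intro isomorphic_quotients_linear_image[OF linear_divide_form subspace_continuous_forms
          inj_on_divide_form[OF dense]])
qed

end

end

theorem proposition3p1:
  fixes X :: "'a topology"
    and A :: "('a, 'e::real_inner) chart set"
    and f :: "'a \<Rightarrow> real"
    and \<theta> :: "('a, 'e) form"
  assumes "smooth_manifold X A"
    and "smooth_fun A f"
    and "X interior_of (zero_set X f) = {}"
    and "\<theta> \<in> forms A (topspace X) 1"
    and "ext_d A (topspace X) 1 \<theta> = 0"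
  shows "isomorphic_cohomology
    (singular_forms X A f) (d_theta A (topspace X - zero_set X f) \<theta>)
    (forms A (topspace X)) (d_f_theta X A f \<theta>)"
  using smooth_manifold.isomorphic_cohomology_singular_forms[OF assms(1,2) refl assms(3,4)] .

end
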